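(* Let $\mathcal{G}$ be a finite $2$-player game and let $X(t)$ be a solution orbit of the stochastically perturbed reinforcement learning process $$dY_{k\alpha}=v_{k\alpha}(X)\,dt+\sigma_{k\alpha}(X)\,dW_{k\alpha},\qquad X_k=Q_k(\eta_kY_k)\qquad(k=1,2,\ \alpha\in\mathcal{A}_k).\tag{SRL}$$ If the players' score differences $Y_{k\alpha}(t)-Y_{k\beta}(t)$ grow sublinearly with $t$ (i.e. are $o(t)$ as $t\to\infty$, almost surely) for all $\alpha,\beta\in\mathcal{A}_k$, $k=1,2$, then the time-averaged process $\bar X(t)=\frac1t\int_0^tX(s)\,ds$ converges almost surely to the set of Nash equilibria of $\mathcal{G}$.
   Context: Game: $\mathcal{N}=\{1,2\}$ is the set of players, $\mathcal{A}_k$ the finite action set of player $k$, $\mathcal{A}=\mathcal{A}_1\times\mathcal{A}_2$, $u_k:\mathcal{A}\to\mathbb{R}$ the payoff functions, extended multilinearly to $\mathcal{X}=\mathcal{X}_1\times\mathcal{X}_2$ with $\mathcal{X}_k=\Delta(\mathcal{A}_k)$ the simplex of mixed strategies. $v_{k\alpha}(x)=u_k(\alpha;x_{-k})$ and $v_k(x)=(v_{k\alpha}(x))_{\alpha\in\mathcal{A}_k}$. $x^\ast\in\mathcal{X}$ is a Nash equilibrium if $u_k(x^\ast)\ge u_k(x_k,x^\ast_{-k})$ for all $x_k\in\mathcal{X}_k$, $k=1,2$. (SRL): the $W_{k\alpha}$ are independent standard Wiener processes (across players and strategies) and the diffusion coefficients $\sigma_{k\alpha}:\mathcal{X}\to\mathbb{R}$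 are Lipschitz. The choice maps are $Q_k(y_k)=\arg\max_{x_k\in\mathcal{X}_k}\{\langle y_k,x_k\rangle-h_k(x_k)\}$, where the penalty function $h_k:\mathcal{X}_k\to\mathbb{R}$ is continuous on $\mathcal{X}_k$, smooth on the relative interior of every face of $\mathcal{X}_k$, and strongly convex: there is $K>0$ with $h_k(tx_k+(1-t)x_k')\le th_k(x_k)+(1-t)h_k(x_k')-\frac12Kt(1-t)\|x_k'-x_k\|^2$ for all $x_k,x_k'\in\mathcal{X}_k$, $t\in[0,1]$. Each learning parameter $\eta_k:[0,\infty)\to(0,\infty)$ is $C^1$-smooth, nonincreasing, with $\lim_{t\to\infty}t\eta_k(t)=+\infty$. Convergence to a set means that the distance to the set tends to $0$. *)

theory Defs
  imports "HOL-Probability.Probability"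
begin

section \<open>Finite two-player games\<close>

text \<open>
  The action sets are finite types \<open>'a\<close> (first player) and \<open>'b\<close> (second player), so that
  mixed strategies live in \<open>real ^ 'a\<close> and \<open>real ^ 'b\<close>.
\<close>

definition mixed_strategies :: "(real ^ 'n) set" where
  "mixed_strategies = {x. (\<forall>i. 0 \<le> x $ i) \<and> (\<Sum>i\<in>UNIV. x $ i) = 1}"

definition mixed_profiles :: "((real ^ 'a) \<times> (real ^ 'b)) set" where
  "mixed_profiles = mixed_strategies \<times> mixed_strategies"

definition expected_payoff ::
  "('a \<times> 'b \<Rightarrow> real) \<Rightarrow> (real ^ 'a) \<times> (real ^ 'b) \<Rightarrow> real" where
  "expected_payoff u x = (\<Sum>a\<in>UNIV. \<Sum>b\<in>UNIV. u (a, b) * (fst x $ a) * (snd x $ b))"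

text \<open>Here \<open>axis a 1\<close> is the vertex of the simplex that stands for the pure strategy \<open>a\<close>.\<close>

definition payoff_vector1 ::
  "('a \<times> 'b \<Rightarrow> real) \<Rightarrow> (real ^ 'a) \<times> (real ^ 'b) \<Rightarrow> real ^ 'a" where
  "payoff_vector1 u x = (\<chi> a. expected_payoff u (axis a 1, snd x))"

definition payoff_vector2 ::
  "('a \<times> 'b \<Rightarrow> real) \<Rightarrow> (real ^ 'a) \<times> (real ^ 'b) \<Rightarrow> real ^ 'b" where
  "payoff_vector2 u x = (\<chi> b. expected_payoff u (fst x, axis b 1))"

definition nash_equilibria ::
  "('a \<times> 'b \<Rightarrow> real) \<Rightarrow> ('a \<times> 'b \<Rightarrow> real) \<Rightarrow> ((real ^ 'a) \<times> (real ^ 'b)) set" where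
  "nash_equilibria u1 u2 = {x \<in> mixed_profiles.
     (\<forall>x1 \<in> mixed_strategies. expected_payoff u1 x \<ge> expected_payoff u1 (x1, snd x)) \<and>
     (\<forall>x2 \<in> mixed_strategies. expected_payoff u2 x \<ge> expected_payoff u2 (fst x, x2))}"


section \<open>Penalty functions, choice maps and learning parameters\<close>

text \<open>
  \<open>C_k_on n S f\<close>: \<open>f\<close> is \<open>n\<close> times continuously differentiable on \<open>S\<close>, with derivatives taken
  within \<open>S\<close>.  On a relatively open convex \<open>S\<close> the derivative is only determined in the directions
  parallel to the affine hull of \<open>S\<close>; composing with the orthogonal projection onto these
  directions shows that asking for a suitable value in every direction \<open>v\<close> is no restriction.
\<close>

primrec C_k_on :: "nat \<Rightarrow> 'v::real_normed_vector set \<Rightarrow> ('v \<Rightarrow> real) \<Rightarrow> bool" where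
  "C_k_on 0 S f \<longleftrightarrow> continuous_on S f"
| "C_k_on (Suc n) S f \<longleftrightarrow>
     (\<exists>f'. (\<forall>x\<in>S. (f has_derivative f' x) (at x within S)) \<and> (\<forall>v. C_k_on n S (\<lambda>x. f' x v)))"

definition smooth_on :: "'v::real_normed_vector set \<Rightarrow> ('v \<Rightarrow> real) \<Rightarrow> bool" where
  "smooth_on S f \<longleftrightarrow> (\<forall>n. C_k_on n S f)"

text \<open>
  Since only the existence of a modulus \<open>K\<close> is required, strong convexity does not depend on the
  choice of the norm.
\<close>

definition strongly_convex_on :: "'v::real_normed_vector set \<Rightarrow> ('v \<Rightarrow> real) \<Rightarrow> bool" where
  "strongly_convex_on S h \<longleftrightarrow> (\<exists>K>0. \<forall>x\<in>S. \<forall>x'\<in>S. \<forall>t\<in>{0..1}.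
     h (t *\<^sub>R x + (1 - t) *\<^sub>R x')
       \<le> t * h x + (1 - t) * h x' - 1 / 2 * K * t * (1 - t) * (norm (x' - x))\<^sup>2)"

definition penalty_function :: "(real ^ 'n \<Rightarrow> real) \<Rightarrow> bool" where
  "penalty_function h \<longleftrightarrow>
     continuous_on mixed_strategies h \<and>
     (\<forall>C. C face_of mixed_strategies \<longrightarrow> smooth_on (rel_interior C) h) \<and>
     strongly_convex_on mixed_strategies h"

definition choice_map :: "(real ^ 'n \<Rightarrow> real) \<Rightarrow> real ^ 'n \<Rightarrow> real ^ 'n" where
  "choice_map h y = arg_max_on (\<lambda>x. y \<bullet> x - h x) mixed_strategies"

definition learning_parameter :: "(real \<Rightarrow> real) \<Rightarrow> bool" where
  "learning_parameter \<eta> \<longleftrightarrow>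
     (\<forall>t\<ge>0. 0 < \<eta> t) \<and> C_k_on 1 {0..} \<eta> \<and> antimono_on {0..} \<eta> \<and>
     filterlim (\<lambda>t. t * \<eta> t) at_top at_top"


section \<open>Wiener processes and the Ito integral\<close>

text \<open>
  Time is \<open>[0, \<infinity>)\<close>.  The values of processes at negative times are never used, and
  a filtration on \<open>[0, \<infinity>)\<close> is regarded as indexed by all reals by putting \<open>F t = F 0\<close>
  for \<open>t < 0\<close>.  The usual conditions are not required.
\<close>

definition filtration_on :: "'w measure \<Rightarrow> (real \<Rightarrow> 'w measure) \<Rightarrow> bool" where
  "filtration_on M F \<longleftrightarrow> filtration (space M) F \<and> (\<forall>t. subalgebra M (F t))"

definition adapted_process ::
  "(real \<Rightarrow> 'w measure) \<Rightarrow> (real \<Rightarrow> 'w \<Rightarrow> 'v::topological_space) \<Rightarrow> bool" where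
  "adapted_process F Z \<longleftrightarrow> (\<forall>t\<ge>0. Z t \<in> borel_measurable (F t))"

definition continuous_process ::
  "'w measure \<Rightarrow> (real \<Rightarrow> 'w \<Rightarrow> 'v::topological_space) \<Rightarrow> bool" where
  "continuous_process M Z \<longleftrightarrow> (AE \<omega> in M. continuous_on {0..} (\<lambda>t. Z t \<omega>))"

definition wiener_process ::
  "'w measure \<Rightarrow> (real \<Rightarrow> 'w measure) \<Rightarrow> (real \<Rightarrow> 'w \<Rightarrow> real) \<Rightarrow> bool" where
  "wiener_process M F W \<longleftrightarrow>
     adapted_process F W \<and> continuous_process M W \<and> (AE \<omega> in M. W 0 \<omega> = 0) \<and>
     (\<forall>s t. 0 \<le> s \<and> s < t \<longrightarrow>
        distributed M lborel (\<lambda>\<omega>. W t \<omega> - W s \<omega>) (normal_density 0 (sqrt (t - s))) \<and>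
        prob_space.indep_set M (sets (F s))
          (sets (vimage_algebra (space M) (\<lambda>\<omega>. W t \<omega> - W s \<omega>) borel)))"

text \<open>
  A finite family of independent standard Wiener processes on one filtration.  The last clause
  says that the increments are \<^emph>\<open>jointly\<close> independent of the past, which does not follow from the
  corresponding property of each single process when \<open>F\<close> is larger than the filtration
  generated by the family.
\<close>

definition independent_wiener_processes ::
  "'w measure \<Rightarrow> (real \<Rightarrow> 'w measure) \<Rightarrow> ('i::finite \<Rightarrow> real \<Rightarrow> 'w \<Rightarrow> real) \<Rightarrow> bool" where
  "independent_wiener_processes M F W \<longleftrightarrow>
     (\<forall>i. wiener_process M F (W i)) \<and>
     prob_space.indep_vars M (\<lambda>_. PiM {0..} (\<lambda>_. borel)) (\<lambda>i \<omega>. \<lambda>t\<in>{0..}. W i t \<omega>) UNIV \<and>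
     (\<forall>s t. 0 \<le> s \<and> s < t \<longrightarrow>
        prob_space.indep_set M (sets (F s))
          (sets (vimage_algebra (space M) (\<lambda>\<omega>. \<chi> i. W i t \<omega> - W i s \<omega>) borel)))"

text \<open>
  The data \<open>(n, \<tau>, \<xi>)\<close> stand for the simple predictable process that equals \<open>\<xi> j\<close> on the
  time interval \<open>(\<tau> j, \<tau> (j + 1)]\<close> for \<open>j < n\<close>, and vanishes elsewhere.
\<close>

definition simple_data ::
  "'w measure \<Rightarrow> (real \<Rightarrow> 'w measure) \<Rightarrow> nat \<Rightarrow> (nat \<Rightarrow> real) \<Rightarrow> (nat \<Rightarrow> 'w \<Rightarrow> real) \<Rightarrow> bool" where
  "simple_data M F n \<tau> \<xi> \<longleftrightarrow>
     0 \<le> \<tau> 0 \<and>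
     (\<forall>j<n. \<tau> j < \<tau> (Suc j) \<and> \<xi> j \<in> borel_measurable (F (\<tau> j)) \<and>
        (\<exists>C. \<forall>\<omega>\<in>space M. \<bar>\<xi> j \<omega>\<bar> \<le> C))"

definition simple_process ::
  "nat \<Rightarrow> (nat \<Rightarrow> real) \<Rightarrow> (nat \<Rightarrow> 'w \<Rightarrow> real) \<Rightarrow> real \<Rightarrow> 'w \<Rightarrow> real" where
  "simple_process n \<tau> \<xi> t \<omega> = (\<Sum>j<n. \<xi> j \<omega> * indicator {\<tau> j<..\<tau> (Suc j)} t)"

definition simple_integral ::
  "(real \<Rightarrow> 'w \<Rightarrow> real) \<Rightarrow> nat \<Rightarrow> (nat \<Rightarrow> real) \<Rightarrow> (nat \<Rightarrow> 'w \<Rightarrow> real) \<Rightarrow> real \<Rightarrow> 'w \<Rightarrow> real"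
  where
  "simple_integral W n \<tau> \<xi> t \<omega> =
     (\<Sum>j<n. \<xi> j \<omega> * (W (min t (\<tau> (Suc j))) \<omega> - W (min t (\<tau> j)) \<omega>))"

text \<open>
  \<open>is_ito_integral M F W H I\<close>: the process \<open>I\<close> is (a continuous version of) \<open>\<integral> H dW\<close>.  This is the
  usual definition for adapted measurable integrands that are square-integrable over
  bounded time intervals: \<open>I\<close> is the mean-square limit of the integrals of simple processes that
  approximate \<open>H\<close> in mean square.  By the Ito isometry \<open>I\<close> is unique up to indistinguishability.
\<close>

definition is_ito_integral ::
  "'w measure \<Rightarrow> (real \<Rightarrow> 'w measure) \<Rightarrow> (real \<Rightarrow> 'w \<Rightarrow> real) \<Rightarrow>
   (real \<Rightarrow> 'w \<Rightarrow> real) \<Rightarrow> (real \<Rightarrow> 'w \<Rightarrow> real) \<Rightarrow> bool" where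
  "is_ito_integral M F W H I \<longleftrightarrow>
     adapted_process F H \<and>
     (\<lambda>(t, \<omega>). H t \<omega>) \<in> borel_measurable (restrict_space lborel {0..} \<Otimes>\<^sub>M M) \<and>
     (\<forall>t\<ge>0. I t \<in> borel_measurable M) \<and> continuous_process M I \<and>
     (\<forall>T\<ge>0. \<exists>n \<tau> \<xi>.
        (\<forall>m. simple_data M F (n m) (\<tau> m) (\<xi> m)) \<and>
        (\<lambda>m. \<integral>\<^sup>+\<omega>. (\<integral>\<^sup>+s\<in>{0..T}.
            ennreal ((simple_process (n m) (\<tau> m) (\<xi> m) s \<omega> - H s \<omega>)\<^sup>2) \<partial>lborel) \<partial>M)
          \<longlonglongrightarrow> 0 \<and>
        (\<forall>t\<in>{0..T}.
          (\<lambda>m. \<integral>\<^sup>+\<omega>. ennreal ((simple_integral W (n m) (\<tau> m) (\<xi> m) t \<omega> - I t \<omega>)\<^sup>2) \<partial>M)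
            \<longlonglongrightarrow> 0))"

text \<open>\<open>has_ito_differential M F W b s Z\<close> is \<open>dZ = b dt + s dW\<close> in integrated form.\<close>

definition has_ito_differential ::
  "'w measure \<Rightarrow> (real \<Rightarrow> 'w measure) \<Rightarrow> (real \<Rightarrow> 'w \<Rightarrow> real) \<Rightarrow>
   (real \<Rightarrow> 'w \<Rightarrow> real) \<Rightarrow> (real \<Rightarrow> 'w \<Rightarrow> real) \<Rightarrow> (real \<Rightarrow> 'w \<Rightarrow> real) \<Rightarrow> bool" where
  "has_ito_differential M F W b s Z \<longleftrightarrow>
     adapted_process F Z \<and> continuous_process M Z \<and>
     (\<exists>I. is_ito_integral M F W s I \<and>
        (AE \<omega> in M. \<forall>t\<ge>0.
           (\<lambda>r. b r \<omega>) absolutely_integrable_on {0..t} \<and>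
           Z t \<omega> = Z 0 \<omega> + integral {0..t} (\<lambda>r. b r \<omega>) + I t \<omega>))"


section \<open>Stochastically perturbed reinforcement learning\<close>

text \<open>
  Families indexed by both players' actions are indexed by \<open>'a + 'b\<close>: \<open>Inl a\<close> is the pair
  (player 1, \<open>a\<close>), \<open>Inr b\<close> the pair (player 2, \<open>b\<close>).  The state process is
  \<open>X t \<omega> = (X\<^sub>1, X\<^sub>2)\<close>, the score processes are \<open>Y1\<close> and \<open>Y2\<close>.
\<close>

definition SRL_solution ::
  "'w measure \<Rightarrow> (real \<Rightarrow> 'w measure) \<Rightarrow> ('a + 'b \<Rightarrow> real \<Rightarrow> 'w \<Rightarrow> real) \<Rightarrow>
   ('a \<times> 'b \<Rightarrow> real) \<Rightarrow> ('a \<times> 'b \<Rightarrow> real) \<Rightarrow>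
   (real ^ 'a \<Rightarrow> real) \<Rightarrow> (real ^ 'b \<Rightarrow> real) \<Rightarrow> (real \<Rightarrow> real) \<Rightarrow> (real \<Rightarrow> real) \<Rightarrow>
   ('a + 'b \<Rightarrow> (real ^ 'a) \<times> (real ^ 'b) \<Rightarrow> real) \<Rightarrow>
   (real \<Rightarrow> 'w \<Rightarrow> real ^ 'a) \<Rightarrow> (real \<Rightarrow> 'w \<Rightarrow> real ^ 'b) \<Rightarrow>
   (real \<Rightarrow> 'w \<Rightarrow> (real ^ 'a) \<times> (real ^ 'b)) \<Rightarrow> bool" where
  "SRL_solution M F W u1 u2 h1 h2 \<eta>1 \<eta>2 \<sigma> Y1 Y2 X \<longleftrightarrow>
     (\<forall>a. has_ito_differential M F (W (Inl a)) (\<lambda>t \<omega>. payoff_vector1 u1 (X t \<omega>) $ a)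
            (\<lambda>t \<omega>. \<sigma> (Inl a) (X t \<omega>)) (\<lambda>t \<omega>. Y1 t \<omega> $ a)) \<and>
     (\<forall>b. has_ito_differential M F (W (Inr b)) (\<lambda>t \<omega>. payoff_vector2 u2 (X t \<omega>) $ b)
            (\<lambda>t \<omega>. \<sigma> (Inr b) (X t \<omega>)) (\<lambda>t \<omega>. Y2 t \<omega> $ b)) \<and>
     (AE \<omega> in M. \<forall>t\<ge>0. X t \<omega> =
        (choice_map h1 (\<eta>1 t *\<^sub>R Y1 t \<omega>), choice_map h2 (\<eta>2 t *\<^sub>R Y2 t \<omega>)))"

definition time_average :: "(real \<Rightarrow> 'w \<Rightarrow> 'v::euclidean_space) \<Rightarrow> real \<Rightarrow> 'w \<Rightarrow> 'v" where
  "time_average X t \<omega> = (1 / t) *\<^sub>R integral {0..t} (\<lambda>s. X s \<omega>)"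

text \<open>
  The first conjunct is there because of the convention \<open>infdist x {} = 0\<close>.
\<close>

definition converges_to_set :: "(real \<Rightarrow> 'v::metric_space) \<Rightarrow> 'v set \<Rightarrow> bool" where
  "converges_to_set x A \<longleftrightarrow> A \<noteq> {} \<and> ((\<lambda>t. infdist (x t) A) \<longlongrightarrow> 0) at_top"

end

theory Submission
  imports Defs
begin

text \<open>
  Write \<open>Z t\<close> for the average of \<open>X\<close> over \<open>[0, t]\<close>.  For two actions \<open>a\<close>, \<open>a'\<close> of a player the
  payoff vector is linear in \<open>X\<close>, so subtracting the two score equations and dividing by \<open>t\<close> gives
  \<open>v\<^sub>a (Z t) - v\<^bsub>a'\<^esub> (Z t)\<close> as \<open>(Y\<^sub>a t - Y\<^bsub>a'\<^esub> t) / t = o(1)\<close> up to an initial term and the noise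
  \<open>(I\<^sub>a t - I\<^bsub>a'\<^esub> t) / t\<close>.  The Ito isometry bounds the second moment of \<open>I t\<close> by a multiple of
  \<open>t\<close>, hence \<open>I t / t\<close> tends to \<open>0\<close> almost surely along the times \<open>t = n\<^sup>2\<close> because the second
  moments are summable.  No maximal inequality is needed to fill the gaps: the payoff difference of
  the time average varies slowly by itself, since the payoffs are bounded.  So in the limit all
  actions of each player earn the same payoff, and such profiles are Nash equilibria;
  compactness of the simplices does the rest.
\<close>

section \<open>Second moments of Ito integrals\<close>

text \<open>\<open>wiener_process\<close> phrases independence through sigma-algebras, while the
  product rule for expectations asks for \<open>indep_var\<close>. The passage works because the
  sigma-algebra generated by \<open>Z\<close> is contained in \<open>sets G\<close>.\<close>

lemma (in prob_space) indep_var_of_indep_set: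
  assumes "subalgebra M G" "Z \<in> borel_measurable G" "random_variable borel D"
    and "indep_set (sets G) (sets (vimage_algebra (space M) D borel))"
  shows "indep_var borel Z borel D"
proof -
  have Z: "random_variable borel Z"
    using assms(1,2) by (rule measurable_from_subalg)
  have sG: "space G = space M" using assms(1) by (simp add: subalgebra_def)
  have 1: "sigma_sets (space M) {Z -` A \<inter> space M |A. A \<in> sets borel} \<subseteq> sets G"
    using assms(2) unfolding sG[symmetric]
    by (intro sets.sigma_sets_subset) (auto intro: measurable_sets)
  have 2: "sigma_sets (space M) {D -` A \<inter> space M |A. A \<in> sets borel}
      = sets (vimage_algebra (space M) D borel)"
    by (simp add: sets_vimage_algebra)
  have "indep_set (sigma_sets (space M) {Z -` A \<inter> space M |A. A \<in> sets borel})
     (sigma_sets (space M) {D -` A \<inter> space M |A. A \<in> sets borel})"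
    using assms(4) 1 unfolding indep_set_def 2
    by (elim indep_sets_mono_sets) (auto split: bool.split)
  then show ?thesis
    unfolding indep_var_eq using Z assms(3) by simp
qed

text \<open>Independence factors the expectations of the product and of its square, and
  \<open>D\<close> has mean \<open>0\<close> and variance \<open>\<sigma>\<^sup>2\<close>. The first
  two claims remove cross terms and the last two evaluate diagonal terms when the square of a simple
  integral is expanded.\<close>

lemma (in prob_space) moments_times_independent_normal:
  fixes Z D :: "'a \<Rightarrow> real"
  assumes sub: "subalgebra M G" and Z: "Z \<in> borel_measurable G"
    and Z2: "integrable M (\<lambda>\<omega>. (Z \<omega>)\<^sup>2)"
    and \<sigma>: "0 < \<sigma>" and D: "distributed M lborel D (normal_density 0 \<sigma>)"
    and ind: "indep_set (sets G) (sets (vimage_algebra (space M) D borel))"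
  shows "integrable M (\<lambda>\<omega>. Z \<omega> * D \<omega>)" and "expectation (\<lambda>\<omega>. Z \<omega> * D \<omega>) = 0"
    and "integrable M (\<lambda>\<omega>. (Z \<omega> * D \<omega>)\<^sup>2)"
    and "expectation (\<lambda>\<omega>. (Z \<omega> * D \<omega>)\<^sup>2) = \<sigma>\<^sup>2 * expectation (\<lambda>\<omega>. (Z \<omega>)\<^sup>2)"
proof -
  have DM: "random_variable borel D"
    using distributed_measurable[OF D] by simp
  have ZM: "random_variable borel Z"
    using sub Z by (rule measurable_from_subalg)
  have iZ: "integrable M Z"
    by (rule square_integrable_imp_integrable[OF ZM Z2])
  have iD: "integrable M D"
    using distributed_integrable_var[OF D] integrable_normal_moment_nz_1[OF \<sigma>, of 0] by simp
  have eD: "expectation D = 0"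
    using normal_distributed_expectation[OF \<sigma> D] .
  have iD2: "integrable M (\<lambda>\<omega>. (D \<omega>)\<^sup>2)"
    using distributed_integrable[OF D, of "\<lambda>x. x\<^sup>2"] integrable_normal_moment[OF \<sigma>, of 0 2] by simp
  have eD2: "expectation (\<lambda>\<omega>. (D \<omega>)\<^sup>2) = \<sigma>\<^sup>2"
    using normal_distributed_variance[OF \<sigma> D] eD by simp
  have iv: "indep_var borel Z borel D"
    by (rule indep_var_of_indep_set[OF sub Z DM ind])
  have "indep_var borel ((\<lambda>x::real. x\<^sup>2) \<circ> Z) borel ((\<lambda>x::real. x\<^sup>2) \<circ> D)"
    by (rule indep_var_compose[OF iv]) auto
  then have iv2: "indep_var borel (\<lambda>\<omega>. (Z \<omega>)\<^sup>2) borel (\<lambda>\<omega>. (D \<omega>)\<^sup>2)"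
    by (simp add: comp_def)
  show "integrable M (\<lambda>\<omega>. Z \<omega> * D \<omega>)"
    by (rule indep_var_integrable[OF iv iZ iD])
  show "expectation (\<lambda>\<omega>. Z \<omega> * D \<omega>) = 0"
    using indep_var_lebesgue_integral[OF iv iZ iD] eD by simp
  show "integrable M (\<lambda>\<omega>. (Z \<omega> * D \<omega>)\<^sup>2)"
    using indep_var_integrable[OF iv2 Z2 iD2] by (simp add: power_mult_distrib)
  show "expectation (\<lambda>\<omega>. (Z \<omega> * D \<omega>)\<^sup>2) = \<sigma>\<^sup>2 * expectation (\<lambda>\<omega>. (Z \<omega>)\<^sup>2)"
    using indep_var_lebesgue_integral[OF iv2 Z2 iD2] eD2 by (simp add: power_mult_distrib mult.commute)
qed

section \<open>Simple integrands and the Ito isometry\<close>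

lemma borel_measurable_filtration_mono:
  assumes "filtration_on M F" "s \<le> t" "Z \<in> borel_measurable (F s)"
  shows "Z \<in> borel_measurable (F t)"
proof -
  interpret filtration "space M" F
    using assms(1) by (simp add: filtration_on_def)
  show ?thesis
    by (rule measurable_from_subalg[OF _ assms(3)])
      (use sets_F_mono[OF assms(2)] in \<open>auto simp: subalgebra_def space_F\<close>)
qed

lemma simple_data_mono:
  assumes "simple_data M F n \<tau> \<xi>" "j \<le> k" "k \<le> n"
  shows "\<tau> j \<le> \<tau> k"
  using assms(2,3)
proof (induction k rule: dec_induct)
  case (step m)
  then have "\<tau> j \<le> \<tau> m" by simp
  also have "\<tau> m < \<tau> (Suc m)" using assms(1) step.prems by (auto simp: simple_data_def)
  finally show ?case by simp
qed simp

lemma simple_data_nonneg: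
  assumes "simple_data M F n \<tau> \<xi>" "k \<le> n"
  shows "0 \<le> \<tau> k"
  using simple_data_mono[OF assms(1), of 0 k] assms by (auto simp: simple_data_def)

lemma simple_data_measurable:
  assumes "filtration_on M F" "simple_data M F n \<tau> \<xi>" "j < n"
  shows "\<xi> j \<in> borel_measurable M"
  using assms unfolding filtration_on_def simple_data_def by (auto intro: measurable_from_subalg)

text \<open>Induction on the number \<open>k\<close> of pieces, with the data kept fixed. The
  partial integral and the next coefficient are measurable at time \<open>\<tau> k\<close>, whereas
  the next increment is independent of that past and has mean zero, so the cross term drops out.
  Measurability is part of the claim because the induction step relies on it.\<close>

lemma (in prob_space) simple_integral_second_moment:
  assumes fil: "filtration_on M F" and W: "wiener_process M F W"
    and sd: "simple_data M F n \<tau> \<xi>" and T: "0 \<le> T" and k: "k \<le> n"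
  shows "simple_integral W k \<tau> \<xi> T \<in> borel_measurable (F (\<tau> k)) \<and>
    integrable M (\<lambda>\<omega>. (simple_integral W k \<tau> \<xi> T \<omega>)\<^sup>2) \<and>
    expectation (\<lambda>\<omega>. (simple_integral W k \<tau> \<xi> T \<omega>)\<^sup>2)
      = (\<Sum>j<k. (min T (\<tau> (Suc j)) - min T (\<tau> j)) * expectation (\<lambda>\<omega>. (\<xi> j \<omega>)\<^sup>2))"
  using k
proof (induction k)
  case 0
  then show ?case by (simp add: simple_integral_def[abs_def])
next
  case (Suc k)
  define S where "S = simple_integral W k \<tau> \<xi> T"
  define D where "D = (\<lambda>\<omega>. W (min T (\<tau> (Suc k))) \<omega> - W (min T (\<tau> k)) \<omega>)"
  have S_Suc: "simple_integral W (Suc k) \<tau> \<xi> T = (\<lambda>\<omega>. S \<omega> + \<xi> k \<omega> * D \<omega>)"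
    by (auto simp: simple_integral_def S_def D_def)
  have SF: "S \<in> borel_measurable (F (\<tau> k))" and S2: "integrable M (\<lambda>\<omega>. (S \<omega>)\<^sup>2)"
    using Suc unfolding S_def by auto
  have ltk: "\<tau> k < \<tau> (Suc k)" and \<xi>F: "\<xi> k \<in> borel_measurable (F (\<tau> k))"
    and "\<exists>C. \<forall>\<omega>\<in>space M. \<bar>\<xi> k \<omega>\<bar> \<le> C"
    using sd Suc.prems by (auto simp: simple_data_def)
  then obtain C where C: "\<And>\<omega>. \<omega> \<in> space M \<Longrightarrow> \<bar>\<xi> k \<omega>\<bar> \<le> C" by auto
  have tk0: "0 \<le> \<tau> k" using simple_data_nonneg[OF sd] Suc.prems by simp
  have sub: "subalgebra M (F t)" for t using fil by (simp add: filtration_on_def)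
  have WF: "W t \<in> borel_measurable (F t)" if "0 \<le> t" for t
    using W that by (auto simp: wiener_process_def adapted_process_def)
  have DF: "D \<in> borel_measurable (F (\<tau> (Suc k)))"
  proof -
    have "W (min T (\<tau> (Suc k))) \<in> borel_measurable (F (\<tau> (Suc k)))"
      by (rule borel_measurable_filtration_mono[OF fil _ WF]) (use T tk0 ltk in auto)
    moreover have "W (min T (\<tau> k)) \<in> borel_measurable (F (\<tau> (Suc k)))"
      by (rule borel_measurable_filtration_mono[OF fil _ WF]) (use T tk0 ltk in auto)
    ultimately show ?thesis unfolding D_def by simp
  qed
  have meas: "simple_integral W (Suc k) \<tau> \<xi> T \<in> borel_measurable (F (\<tau> (Suc k)))"
    unfolding S_Suc
    using borel_measurable_filtration_mono[OF fil less_imp_le[OF ltk] SF]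
      borel_measurable_filtration_mono[OF fil less_imp_le[OF ltk] \<xi>F] DF by simp
  have \<xi>M: "\<xi> k \<in> borel_measurable M"
    using \<xi>F by (rule measurable_from_subalg[OF sub])
  have SM: "S \<in> borel_measurable M"
    using SF by (rule measurable_from_subalg[OF sub])
  have C2: "(\<xi> k \<omega>)\<^sup>2 \<le> C\<^sup>2" if "\<omega> \<in> space M" for \<omega>
    using C[OF that] by (metis abs_ge_zero power2_abs power_mono)
  have \<xi>2: "integrable M (\<lambda>\<omega>. (\<xi> k \<omega>)\<^sup>2)"
    using C2 \<xi>M by (intro integrable_const_bound[where B="C\<^sup>2"]) auto
  \<comment> \<open>\<open>S * \<xi> k\<close> plays the role of \<open>Z\<close> for the cross
    term, so it must be square integrable; the bound on \<open>\<xi> k\<close> reduces this to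
    \<open>S\<close>.\<close>
  have S\<xi>: "integrable M (\<lambda>\<omega>. (S \<omega> * \<xi> k \<omega>)\<^sup>2)"
  proof (rule Bochner_Integration.integrable_bound)
    show "integrable M (\<lambda>\<omega>. C\<^sup>2 * (S \<omega>)\<^sup>2)" using S2 by simp
    show "(\<lambda>\<omega>. (S \<omega> * \<xi> k \<omega>)\<^sup>2) \<in> borel_measurable M" using SM \<xi>M by simp
    show "AE \<omega> in M. norm ((S \<omega> * \<xi> k \<omega>)\<^sup>2) \<le> norm (C\<^sup>2 * (S \<omega>)\<^sup>2)"
      using C2 by (intro AE_I2) (simp add: power_mult_distrib mult.commute[of "(S _)\<^sup>2"] mult_right_mono)
  qed
  show ?case
  \<comment> \<open>If the piece starts at or after \<open>T\<close>, both of its end points are cut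
    down to \<open>T\<close> and nothing is added. Otherwise the increment has positive length, as a
    nondegenerate normal law requires.\<close>
  proof (cases "\<tau> k < T")
    case False
    then have "D = (\<lambda>\<omega>. 0)" "min T (\<tau> (Suc k)) - min T (\<tau> k) = 0"
      using ltk by (auto simp: D_def min_def)
    then show ?thesis using Suc meas S2 unfolding S_Suc by (simp add: S_def)
  next
    case True
    define r where "r = min T (\<tau> (Suc k))"
    have r: "\<tau> k < r" "min T (\<tau> k) = \<tau> k" using True ltk by (auto simp: r_def)
    have D_eq: "D = (\<lambda>\<omega>. W r \<omega> - W (\<tau> k) \<omega>)"
      unfolding D_def r_def[symmetric] r(2) ..
    have dist: "distributed M lborel D (normal_density 0 (sqrt (r - \<tau> k)))"
      and ind: "indep_set (sets (F (\<tau> k))) (sets (vimage_algebra (space M) D borel))"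
      using W r tk0 unfolding wiener_process_def D_eq by auto
    have pos: "0 < sqrt (r - \<tau> k)" using r by simp
    note m1 = moments_times_independent_normal[OF sub borel_measurable_times[OF SF \<xi>F] S\<xi> pos dist ind]
    note m2 = moments_times_independent_normal[OF sub \<xi>F \<xi>2 pos dist ind]
    have sq: "(S \<omega> + \<xi> k \<omega> * D \<omega>)\<^sup>2 = (S \<omega>)\<^sup>2 + 2 * (S \<omega> * \<xi> k \<omega> * D \<omega>) + (\<xi> k \<omega> * D \<omega>)\<^sup>2" for \<omega>
      by (simp add: power2_eq_square algebra_simps)
    have "integrable M (\<lambda>\<omega>. (S \<omega> + \<xi> k \<omega> * D \<omega>)\<^sup>2)"
      unfolding sq using S2 m1(1) m2(3) by simp
    moreover have "expectation (\<lambda>\<omega>. (S \<omega> + \<xi> k \<omega> * D \<omega>)\<^sup>2)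
        = expectation (\<lambda>\<omega>. (S \<omega>)\<^sup>2) + (r - \<tau> k) * expectation (\<lambda>\<omega>. (\<xi> k \<omega>)\<^sup>2)"
      unfolding sq using S2 m1(1,2) m2(3,4) r by simp
    moreover have "expectation (\<lambda>\<omega>. (S \<omega>)\<^sup>2)
        = (\<Sum>j<k. (min T (\<tau> (Suc j)) - min T (\<tau> j)) * expectation (\<lambda>\<omega>. (\<xi> j \<omega>)\<^sup>2))"
      using Suc by (simp add: S_def)
    ultimately show ?thesis
      using meas unfolding S_Suc by (simp add: r_def[symmetric] r(2))
  qed
qed

text \<open>Pathwise counterpart of the second moment formula: the time intervals of the pieces are
  disjoint, so squaring produces no mixed products, and each piece contributes its squared value
  times its length inside \<open>{0..T}\<close>.\<close>

lemma nn_integral_simple_process_square: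
  assumes sd: "simple_data M F n \<tau> \<xi>" and T: "0 \<le> T" and k: "k \<le> n"
  shows "(\<integral>\<^sup>+s\<in>{0..T}. ennreal ((simple_process k \<tau> \<xi> s \<omega>)\<^sup>2) \<partial>lborel)
    = ennreal (\<Sum>j<k. (min T (\<tau> (Suc j)) - min T (\<tau> j)) * (\<xi> j \<omega>)\<^sup>2)"
  using k
proof (induction k)
  case 0
  then show ?case by (simp add: simple_process_def)
next
  case (Suc k)
  have mono: "\<tau> j \<le> \<tau> (Suc j)" if "j < n" for j
    using simple_data_mono[OF sd, of j "Suc j"] that by simp
  have tk0: "0 \<le> \<tau> k" using simple_data_nonneg[OF sd] Suc.prems by simp
  \<comment> \<open>All earlier pieces have ended by \<open>\<tau> k\<close>, so the old sum and the
    new piece are never nonzero together.\<close>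
  have vanish: "simple_process k \<tau> \<xi> s \<omega> = 0" if "\<tau> k < s" for s
    unfolding simple_process_def
  proof (intro sum.neutral ballI)
    fix j assume "j \<in> {..<k}"
    then have "\<tau> (Suc j) \<le> \<tau> k" using simple_data_mono[OF sd, of "Suc j" k] Suc.prems by auto
    then show "\<xi> j \<omega> * indicator {\<tau> j<..\<tau> (Suc j)} s = 0" using that by (auto simp: indicator_def)
  qed
  have meas: "(\<lambda>s. simple_process k \<tau> \<xi> s \<omega>) \<in> borel_measurable lborel"
    unfolding simple_process_def by measurable
  define J where "J = {\<tau> k<..\<tau> (Suc k)} \<inter> {0..T}"
  have "(\<integral>\<^sup>+s\<in>{0..T}. ennreal ((simple_process (Suc k) \<tau> \<xi> s \<omega>)\<^sup>2) \<partial>lborel)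
     = (\<integral>\<^sup>+s. ennreal ((simple_process k \<tau> \<xi> s \<omega>)\<^sup>2) * indicator {0..T} s
          + ennreal ((\<xi> k \<omega>)\<^sup>2) * indicator J s \<partial>lborel)"
  proof (intro nn_integral_cong)
    fix s
    show "ennreal ((simple_process (Suc k) \<tau> \<xi> s \<omega>)\<^sup>2) * indicator {0..T} s =
          ennreal ((simple_process k \<tau> \<xi> s \<omega>)\<^sup>2) * indicator {0..T} s
          + ennreal ((\<xi> k \<omega>)\<^sup>2) * indicator J s"
      using vanish[of s] by (cases "s \<in> {\<tau> k<..\<tau> (Suc k)}")
        (auto simp: simple_process_def J_def indicator_def)
  qed
  also have "\<dots> = (\<integral>\<^sup>+s\<in>{0..T}. ennreal ((simple_process k \<tau> \<xi> s \<omega>)\<^sup>2) \<partial>lborel)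
      + ennreal ((\<xi> k \<omega>)\<^sup>2) * emeasure lborel J"
    using meas by (subst nn_integral_add) (auto simp: J_def nn_integral_cmult_indicator)
  \<comment> \<open>Cutting with \<open>{0..T}\<close> loses nothing at the left end since
    \<open>0 \<le> \<tau> k\<close>; for \<open>T \<le> \<tau> k\<close> both sides are
    empty.\<close>
  also have "J = {min T (\<tau> k) <.. min T (\<tau> (Suc k))}"
    using T tk0 by (auto simp: J_def)
  also have "emeasure lborel {min T (\<tau> k) <.. min T (\<tau> (Suc k))}
      = ennreal (min T (\<tau> (Suc k)) - min T (\<tau> k))"
    using mono[of k] Suc.prems by (intro emeasure_lborel_Ioc) auto
  also have "(\<integral>\<^sup>+s\<in>{0..T}. ennreal ((simple_process k \<tau> \<xi> s \<omega>)\<^sup>2) \<partial>lborel)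
    = ennreal (\<Sum>j<k. (min T (\<tau> (Suc j)) - min T (\<tau> j)) * (\<xi> j \<omega>)\<^sup>2)"
    using Suc by simp
  also have "ennreal ((\<xi> k \<omega>)\<^sup>2) * ennreal (min T (\<tau> (Suc k)) - min T (\<tau> k))
    = ennreal ((min T (\<tau> (Suc k)) - min T (\<tau> k)) * (\<xi> k \<omega>)\<^sup>2)"
    by (simp add: ennreal_mult'[symmetric] mult.commute)
  also have "ennreal (\<Sum>j<k. (min T (\<tau> (Suc j)) - min T (\<tau> j)) * (\<xi> j \<omega>)\<^sup>2) + \<dots>
    = ennreal (\<Sum>j<Suc k. (min T (\<tau> (Suc j)) - min T (\<tau> j)) * (\<xi> j \<omega>)\<^sup>2)"
    using Suc.prems mono
    by (subst ennreal_plus[symmetric])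
      (auto intro!: sum_nonneg mult_nonneg_nonneg simp: min_le_iff_disj)
  finally show ?case .
qed

text \<open>Both sides reduce to the same sum of truncated interval lengths times second moments of
  the coefficients: the left one by orthogonality of the pieces, the right one by carrying out the
  time integral first.\<close>

lemma (in prob_space) simple_ito_isometry:
  assumes fil: "filtration_on M F" and W: "wiener_process M F W"
    and sd: "simple_data M F n \<tau> \<xi>" and T: "0 \<le> T"
  shows "(\<integral>\<^sup>+\<omega>. ennreal ((simple_integral W n \<tau> \<xi> T \<omega>)\<^sup>2) \<partial>M)
    = (\<integral>\<^sup>+\<omega>. (\<integral>\<^sup>+s\<in>{0..T}. ennreal ((simple_process n \<tau> \<xi> s \<omega>)\<^sup>2) \<partial>lborel) \<partial>M)"
proof -
  note step = simple_integral_second_moment[OF fil W sd T order_refl]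
  have \<xi>2: "integrable M (\<lambda>\<omega>. (\<xi> j \<omega>)\<^sup>2)" if j: "j < n" for j
  proof -
    obtain C where "\<forall>\<omega>\<in>space M. \<bar>\<xi> j \<omega>\<bar> \<le> C"
      using sd j unfolding simple_data_def by blast
    then have "(\<xi> j \<omega>)\<^sup>2 \<le> C\<^sup>2" if "\<omega> \<in> space M" for \<omega>
      using that by (metis abs_ge_zero power2_abs power_mono)
    then show ?thesis
      using simple_data_measurable[OF fil sd j]
      by (intro integrable_const_bound[where B="C\<^sup>2"]) auto
  qed
  have nonneg: "0 \<le> min T (\<tau> (Suc j)) - min T (\<tau> j)" if "j < n" for j
    using simple_data_mono[OF sd, of j "Suc j"] that by auto
  have "(\<integral>\<^sup>+\<omega>. ennreal ((simple_integral W n \<tau> \<xi> T \<omega>)\<^sup>2) \<partial>M)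
    = ennreal (\<Sum>j<n. (min T (\<tau> (Suc j)) - min T (\<tau> j)) * expectation (\<lambda>\<omega>. (\<xi> j \<omega>)\<^sup>2))"
    using step by (subst nn_integral_eq_integral) auto
  also have "\<dots> = ennreal (expectation (\<lambda>\<omega>. \<Sum>j<n. (min T (\<tau> (Suc j)) - min T (\<tau> j)) * (\<xi> j \<omega>)\<^sup>2))"
    using \<xi>2 by (subst Bochner_Integration.integral_sum) auto
  also have "\<dots> = (\<integral>\<^sup>+\<omega>. ennreal (\<Sum>j<n. (min T (\<tau> (Suc j)) - min T (\<tau> j)) * (\<xi> j \<omega>)\<^sup>2) \<partial>M)"
    using \<xi>2 nonneg
    by (intro nn_integral_eq_integral[symmetric])
      (auto intro!: AE_I2 sum_nonneg mult_nonneg_nonneg simp del: diff_ge_0_iff_ge)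
  also have "\<dots> = (\<integral>\<^sup>+\<omega>. (\<integral>\<^sup>+s\<in>{0..T}. ennreal ((simple_process n \<tau> \<xi> s \<omega>)\<^sup>2) \<partial>lborel) \<partial>M)"
    by (simp only: nn_integral_simple_process_square[OF sd T order_refl])
  finally show ?thesis .
qed

section \<open>Bounded integrands: second moments and decay of the noise\<close>

text \<open>The isometry for the approximating simple processes is carried to the mean-square limit.
  The crude inequality \<open>sq_le\<close> is used once for the integrands and once for the
  integrals; each use costs a factor \<open>2\<close>, whence the \<open>4\<close>. What matters
  later is that the bound is linear in \<open>T\<close>.\<close>

lemma (in prob_space) ito_integral_second_moment_le:
  assumes fil: "filtration_on M F" and W: "wiener_process M F W"
    and ito: "is_ito_integral M F W H I"
    and bd: "AE \<omega> in M. \<forall>s\<ge>0. \<bar>H s \<omega>\<bar> \<le> C" and T: "0 \<le> T"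
  shows "(\<integral>\<^sup>+\<omega>. ennreal ((I T \<omega>)\<^sup>2) \<partial>M) \<le> ennreal (4 * C\<^sup>2 * T)"
proof -
  from ito[unfolded is_ito_integral_def, THEN conjunct2, THEN conjunct2, THEN conjunct2,
      THEN conjunct2, THEN spec, THEN mp, OF T]
  obtain n \<tau> \<xi> where sd': "\<forall>m. simple_data M F (n m) (\<tau> m) (\<xi> m)"
    and a0: "(\<lambda>m. \<integral>\<^sup>+\<omega>. (\<integral>\<^sup>+s\<in>{0..T}.
            ennreal ((simple_process (n m) (\<tau> m) (\<xi> m) s \<omega> - H s \<omega>)\<^sup>2) \<partial>lborel) \<partial>M) \<longlonglongrightarrow> 0"
    and b0': "\<forall>t\<in>{0..T}.
        (\<lambda>m. \<integral>\<^sup>+\<omega>. ennreal ((simple_integral W (n m) (\<tau> m) (\<xi> m) t \<omega> - I t \<omega>)\<^sup>2) \<partial>M)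
          \<longlonglongrightarrow> 0"
    by blast
  note sd = sd'[rule_format]
  have b0: "(\<lambda>m. \<integral>\<^sup>+\<omega>. ennreal ((simple_integral W (n m) (\<tau> m) (\<xi> m) T \<omega> - I T \<omega>)\<^sup>2) \<partial>M)
            \<longlonglongrightarrow> 0"
    using b0' T by simp
  define a where "a m = (\<integral>\<^sup>+\<omega>. (\<integral>\<^sup>+s\<in>{0..T}.
            ennreal ((simple_process (n m) (\<tau> m) (\<xi> m) s \<omega> - H s \<omega>)\<^sup>2) \<partial>lborel) \<partial>M)" for m
  define b where "b m = (\<integral>\<^sup>+\<omega>. ennreal ((simple_integral W (n m) (\<tau> m) (\<xi> m) T \<omega> - I T \<omega>)\<^sup>2) \<partial>M)"
    for m
  have IM: "I T \<in> borel_measurable M" using ito T by (simp add: is_ito_integral_def)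
  \<comment> \<open>\<open>H\<close> is only known to be measurable for nonnegative times, so it is frozen before \<open>0\<close>.\<close>
  have "(\<lambda>p. (max (snd p) 0, fst p)) \<in> measurable (M \<Otimes>\<^sub>M lborel) (restrict_space lborel {0::real..} \<Otimes>\<^sub>M M)"
    by (intro measurable_Pair measurable_restrict_space2) auto
  moreover have "(\<lambda>(t, \<omega>). H t \<omega>) \<in> borel_measurable (restrict_space lborel {0..} \<Otimes>\<^sub>M M)"
    using ito by (simp add: is_ito_integral_def)
  ultimately have HM: "(\<lambda>p. H (max (snd p) 0) (fst p)) \<in> borel_measurable (M \<Otimes>\<^sub>M lborel)"
    by (auto dest: measurable_compose)
  have sq_le: "ennreal (x\<^sup>2) \<le> 2 * ennreal ((x - y)\<^sup>2) + 2 * ennreal (y\<^sup>2)" for x y :: real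
  proof -
    have "0 \<le> (x - 2 * y)\<^sup>2" by simp
    then have "x\<^sup>2 \<le> 2 * (x - y)\<^sup>2 + 2 * y\<^sup>2" by (simp add: power2_eq_square algebra_simps)
    then have "ennreal (x\<^sup>2) \<le> ennreal (2 * (x - y)\<^sup>2 + 2 * y\<^sup>2)" by (rule ennreal_leI)
    then show ?thesis by (simp add: ennreal_mult')
  qed
  have bound: "(\<integral>\<^sup>+\<omega>. ennreal ((I T \<omega>)\<^sup>2) \<partial>M) \<le> 2 * b m + 2 * (2 * a m + ennreal (2 * C\<^sup>2 * T))" for m
  proof -
    let ?\<phi> = "simple_process (n m) (\<tau> m) (\<xi> m)" and ?S = "simple_integral W (n m) (\<tau> m) (\<xi> m) T"
    have sub: "subalgebra M (F t)" for t using fil by (simp add: filtration_on_def)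
    have SM: "?S \<in> borel_measurable M"
      using simple_integral_second_moment[OF fil W sd T order_refl] by (auto intro: measurable_from_subalg[OF sub])
    have "(\<lambda>p. ?\<phi> (snd p) (fst p)) \<in> borel_measurable (M \<Otimes>\<^sub>M lborel)"
      unfolding simple_process_def
    proof (intro borel_measurable_sum borel_measurable_times)
      fix j assume "j \<in> {..<n m}"
      then have [measurable]: "\<xi> m j \<in> borel_measurable M"
        using simple_data_measurable[OF fil sd] by simp
      show "(\<lambda>p. \<xi> m j (fst p)) \<in> borel_measurable (M \<Otimes>\<^sub>M lborel)" by measurable
      show "(\<lambda>p. indicator {\<tau> m j<..\<tau> m (Suc j)} (snd p) :: real) \<in> borel_measurable (M \<Otimes>\<^sub>M lborel)"
        by measurable
    qed
    with HM have fM: "(\<lambda>p. ennreal ((?\<phi> (snd p) (fst p) - H (max (snd p) 0) (fst p))\<^sup>2) * indicator {0..T} (snd p))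
        \<in> borel_measurable (M \<Otimes>\<^sub>M lborel)"
      by measurable
    have f_eq: "ennreal ((?\<phi> s \<omega> - H (max s 0) \<omega>)\<^sup>2) * indicator {0..T} s
       = ennreal ((?\<phi> s \<omega> - H s \<omega>)\<^sup>2) * indicator {0..T} s" for s \<omega>
      by (auto simp: indicator_def max_def)
    have f1: "(\<lambda>s. ennreal ((?\<phi> s \<omega> - H s \<omega>)\<^sup>2) * indicator {0..T} s) \<in> borel_measurable lborel"
      if "\<omega> \<in> space M" for \<omega>
      using measurable_compose[OF measurable_Pair1'[OF that] fM] by (simp add: f_eq)
    have f2: "(\<lambda>\<omega>. \<integral>\<^sup>+s\<in>{0..T}. ennreal ((?\<phi> s \<omega> - H s \<omega>)\<^sup>2) \<partial>lborel) \<in> borel_measurable M"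
      using lborel.borel_measurable_nn_integral_fst[OF fM] by (simp add: f_eq)
    have inner: "(\<integral>\<^sup>+s\<in>{0..T}. ennreal ((?\<phi> s \<omega>)\<^sup>2) \<partial>lborel)
        \<le> 2 * (\<integral>\<^sup>+s\<in>{0..T}. ennreal ((?\<phi> s \<omega> - H s \<omega>)\<^sup>2) \<partial>lborel) + ennreal (2 * C\<^sup>2 * T)"
      if \<omega>: "\<omega> \<in> space M" and H: "\<forall>s\<ge>0. \<bar>H s \<omega>\<bar> \<le> C" for \<omega>
    proof -
      have "(\<integral>\<^sup>+s\<in>{0..T}. ennreal ((?\<phi> s \<omega>)\<^sup>2) \<partial>lborel)
        \<le> (\<integral>\<^sup>+s. 2 * (ennreal ((?\<phi> s \<omega> - H s \<omega>)\<^sup>2) * indicator {0..T} s)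
               + ennreal (2 * C\<^sup>2) * indicator {0..T} s \<partial>lborel)"
      proof (intro nn_integral_mono)
        fix s
        show "ennreal ((?\<phi> s \<omega>)\<^sup>2) * indicator {0..T} s \<le> 2 * (ennreal ((?\<phi> s \<omega> - H s \<omega>)\<^sup>2) * indicator {0..T} s)
               + ennreal (2 * C\<^sup>2) * indicator {0..T} s"
        proof (cases "s \<in> {0..T}")
          case True
          then have "\<bar>H s \<omega>\<bar> \<le> C" using H by auto
          then have "(H s \<omega>)\<^sup>2 \<le> C\<^sup>2" by (metis abs_ge_zero power2_abs power_mono)
          then have "2 * ennreal ((H s \<omega>)\<^sup>2) \<le> ennreal (2 * C\<^sup>2)"
            by (simp add: ennreal_mult' mult_left_mono ennreal_leI)
          then show ?thesis
            using True sq_le[of "?\<phi> s \<omega>" "H s \<omega>"] by (auto intro: order_trans add_left_mono)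
        qed simp
      qed
      also have "\<dots> = 2 * (\<integral>\<^sup>+s\<in>{0..T}. ennreal ((?\<phi> s \<omega> - H s \<omega>)\<^sup>2) \<partial>lborel) + ennreal (2 * C\<^sup>2) * ennreal T"
        using f1[OF \<omega>] T by (subst nn_integral_add) (auto simp: nn_integral_cmult nn_integral_cmult_indicator)
      finally show ?thesis using T by (simp add: ennreal_mult')
    qed
    have "(\<integral>\<^sup>+\<omega>. ennreal ((?S \<omega>)\<^sup>2) \<partial>M) = (\<integral>\<^sup>+\<omega>. (\<integral>\<^sup>+s\<in>{0..T}. ennreal ((?\<phi> s \<omega>)\<^sup>2) \<partial>lborel) \<partial>M)"
      by (rule simple_ito_isometry[OF fil W sd T])
    also have "\<dots> \<le> (\<integral>\<^sup>+\<omega>. 2 * (\<integral>\<^sup>+s\<in>{0..T}. ennreal ((?\<phi> s \<omega> - H s \<omega>)\<^sup>2) \<partial>lborel) + ennreal (2 * C\<^sup>2 * T) \<partial>M)"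
    proof (rule nn_integral_mono_AE)
      show "AE \<omega> in M. (\<integral>\<^sup>+s\<in>{0..T}. ennreal ((?\<phi> s \<omega>)\<^sup>2) \<partial>lborel)
        \<le> 2 * (\<integral>\<^sup>+s\<in>{0..T}. ennreal ((?\<phi> s \<omega> - H s \<omega>)\<^sup>2) \<partial>lborel) + ennreal (2 * C\<^sup>2 * T)"
        using AE_space[of M] bd by eventually_elim (rule inner)
    qed
    also have "\<dots> = 2 * a m + ennreal (2 * C\<^sup>2 * T)"
      using f2 by (subst nn_integral_add) (auto simp: a_def nn_integral_cmult emeasure_space_1)
    finally have S2: "(\<integral>\<^sup>+\<omega>. ennreal ((?S \<omega>)\<^sup>2) \<partial>M) \<le> 2 * a m + ennreal (2 * C\<^sup>2 * T)" .
    have "(\<integral>\<^sup>+\<omega>. ennreal ((I T \<omega>)\<^sup>2) \<partial>M)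
        \<le> (\<integral>\<^sup>+\<omega>. 2 * ennreal ((I T \<omega> - ?S \<omega>)\<^sup>2) + 2 * ennreal ((?S \<omega>)\<^sup>2) \<partial>M)"
      by (intro nn_integral_mono sq_le)
    also have "\<dots> = 2 * b m + 2 * (\<integral>\<^sup>+\<omega>. ennreal ((?S \<omega>)\<^sup>2) \<partial>M)"
      using SM IM by (subst nn_integral_add) (auto simp: b_def nn_integral_cmult power2_commute)
    also have "\<dots> \<le> 2 * b m + 2 * (2 * a m + ennreal (2 * C\<^sup>2 * T))"
      by (intro add_left_mono mult_left_mono S2) simp
    finally show ?thesis .
  qed
  \<comment> \<open>Both approximation errors vanish in the limit, and only the constant part of
    \<open>bound\<close> survives.\<close>
  have "(\<lambda>m. 2 * b m + 2 * (2 * a m + ennreal (2 * C\<^sup>2 * T))) \<longlonglongrightarrow> 2 * 0 + 2 * (2 * 0 + ennreal (2 * C\<^sup>2 * T))"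
    using a0 b0 unfolding a_def b_def
    by (intro tendsto_add ennreal_tendsto_cmult tendsto_const) auto
  then have "(\<integral>\<^sup>+\<omega>. ennreal ((I T \<omega>)\<^sup>2) \<partial>M) \<le> 2 * 0 + 2 * (2 * 0 + ennreal (2 * C\<^sup>2 * T))"
    by (rule LIMSEQ_le_const) (use bound in auto)
  also have "\<dots> = ennreal (2 * (2 * C\<^sup>2 * T))"
    by (subst ennreal_mult') (auto simp: T)
  finally show ?thesis by (simp add: mult.assoc)
qed

text \<open>At time \<open>r\<^sup>2\<close> the second moment of \<open>I / r\<^sup>2\<close> is at
  most \<open>4 * C\<^sup>2 / r\<^sup>2\<close>, which is summable over \<open>r\<close>; at integer
  times the same estimate would only give a harmonic series. So the sum of the squares has finite
  expectation, is almost surely finite, and its terms tend to \<open>0\<close>.\<close>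

lemma (in prob_space) ito_integral_along_squares:
  assumes fil: "filtration_on M F" and W: "wiener_process M F W"
    and ito: "is_ito_integral M F W H I"
    and bd: "AE \<omega> in M. \<forall>s\<ge>0. \<bar>H s \<omega>\<bar> \<le> C"
  shows "AE \<omega> in M. (\<lambda>n. I ((real (Suc n))\<^sup>2) \<omega> / (real (Suc n))\<^sup>2) \<longlonglongrightarrow> 0"
proof -
  define J where "J n \<omega> = I ((real (Suc n))\<^sup>2) \<omega> / (real (Suc n))\<^sup>2" for n \<omega>
  have IM: "I t \<in> borel_measurable M" if "0 \<le> t" for t
    using ito that by (simp add: is_ito_integral_def)
  have JM: "(\<lambda>\<omega>. ennreal ((J n \<omega>)\<^sup>2)) \<in> borel_measurable M" for n
    unfolding J_def using IM[of "(real (Suc n))\<^sup>2"] by simp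
  have J2: "(\<integral>\<^sup>+\<omega>. ennreal ((J n \<omega>)\<^sup>2) \<partial>M) \<le> ennreal (4 * C\<^sup>2 * inverse ((real (Suc n))\<^sup>2))" for n
  proof -
    let ?r = "real (Suc n)"
    have "(\<integral>\<^sup>+\<omega>. ennreal ((J n \<omega>)\<^sup>2) \<partial>M)
        = (\<integral>\<^sup>+\<omega>. ennreal (inverse (?r ^ 4)) * ennreal ((I (?r\<^sup>2) \<omega>)\<^sup>2) \<partial>M)"
      by (intro nn_integral_cong)
        (simp add: J_def power_mult_distrib power_inverse divide_inverse mult.commute ennreal_mult'[symmetric]
          flip: power_mult del: of_nat_Suc)
    also have "\<dots> = ennreal (inverse (?r ^ 4)) * (\<integral>\<^sup>+\<omega>. ennreal ((I (?r\<^sup>2) \<omega>)\<^sup>2) \<partial>M)"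
      using IM[of "?r\<^sup>2"] by (intro nn_integral_cmult) simp
    also have "\<dots> \<le> ennreal (inverse (?r ^ 4)) * ennreal (4 * C\<^sup>2 * ?r\<^sup>2)"
      by (intro mult_left_mono ito_integral_second_moment_le[OF fil W ito bd]) auto
    also have "\<dots> = ennreal (inverse (?r ^ 4) * (4 * C\<^sup>2 * ?r\<^sup>2))"
      by (subst ennreal_mult') auto
    also have "inverse (?r ^ 4) * (4 * C\<^sup>2 * ?r\<^sup>2) = 4 * C\<^sup>2 * inverse (?r\<^sup>2)"
      by (simp add: field_simps power2_eq_square power4_eq_xxxx del: of_nat_Suc)
    finally show ?thesis .
  qed
  have "summable (\<lambda>n. inverse ((real n)\<^sup>2))"
    by (rule inverse_power_summable) simp
  then have "summable (\<lambda>n. 4 * C\<^sup>2 * inverse ((real (Suc n))\<^sup>2))"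
    by (intro summable_mult summable_Suc_iff[THEN iffD2])
  then have "(\<Sum>n. ennreal (4 * C\<^sup>2 * inverse ((real (Suc n))\<^sup>2))) \<noteq> top"
    by (intro ennreal_suminf_neq_top) auto
  moreover have "(\<integral>\<^sup>+\<omega>. (\<Sum>n. ennreal ((J n \<omega>)\<^sup>2)) \<partial>M) \<le> (\<Sum>n. ennreal (4 * C\<^sup>2 * inverse ((real (Suc n))\<^sup>2)))"
    using JM J2 by (subst nn_integral_suminf) (auto intro!: suminf_le)
  ultimately have "(\<integral>\<^sup>+\<omega>. (\<Sum>n. ennreal ((J n \<omega>)\<^sup>2)) \<partial>M) \<noteq> \<infinity>"
    by (auto simp: top_unique)
  then have "AE \<omega> in M. (\<Sum>n. ennreal ((J n \<omega>)\<^sup>2)) \<noteq> \<infinity>"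
    using JM by (intro nn_integral_PInf_AE) auto
  then have "AE \<omega> in M. (\<lambda>n. J n \<omega>) \<longlonglongrightarrow> 0"
  proof eventually_elim
    case (elim \<omega>)
    then have "summable (\<lambda>n. (J n \<omega>)\<^sup>2)" by (intro summable_suminf_not_top) auto
    then have "(\<lambda>n. sqrt ((J n \<omega>)\<^sup>2)) \<longlonglongrightarrow> sqrt 0"
      by (intro tendsto_real_sqrt summable_LIMSEQ_zero)
    then show ?case by (simp add: tendsto_rabs_zero_iff)
  qed
  then show ?thesis by (simp add: J_def)
qed

section \<open>Choice maps and payoffs\<close>

lemma compact_mixed_strategies: "compact (mixed_strategies :: (real ^ 'n) set)"
proof -
  have "norm x \<le> 1" if "x \<in> mixed_strategies" for x :: "real ^ 'n"
  proof -
    have "norm x \<le> (\<Sum>i\<in>UNIV. \<bar>x $ i\<bar>)" by (rule norm_le_l1_cart)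
    also have "\<dots> = 1" using that by (simp add: mixed_strategies_def)
    finally show ?thesis .
  qed
  then have "bounded (mixed_strategies :: (real ^ 'n) set)" by (auto simp: bounded_iff)
  moreover have "closed (mixed_strategies :: (real ^ 'n) set)"
    unfolding mixed_strategies_def
    by (intro closed_Collect_conj closed_Collect_all closed_Collect_le closed_Collect_eq continuous_intros)
  ultimately show ?thesis by (simp add: compact_eq_bounded_closed)
qed

lemma axis_in_mixed_strategies: "axis i 1 \<in> mixed_strategies"
  by (simp add: mixed_strategies_def axis_def)

lemma convex_mixed_strategies: "convex (mixed_strategies :: (real ^ 'n) set)"
  by (auto simp: convex_def mixed_strategies_def sum.distrib simp flip: sum_distrib_left)

lemma penalty_function_continuous_on: "penalty_function h \<Longrightarrow> continuous_on mixed_strategies h"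
  by (simp add: penalty_function_def)

text \<open>\<open>arg_max_on\<close> selects by Hilbert choice and carries information only when a
  maximizer exists; compactness of the simplex together with continuity of \<open>h\<close> supplies
  one.\<close>

lemma choice_map_maximizes:
  assumes "continuous_on mixed_strategies h"
  shows "choice_map h y \<in> mixed_strategies"
    and "\<And>x. x \<in> mixed_strategies \<Longrightarrow> y \<bullet> x - h x \<le> y \<bullet> choice_map h y - h (choice_map h y)"
proof -
  have "\<exists>z\<in>mixed_strategies. \<forall>x\<in>mixed_strategies. y \<bullet> x - h x \<le> y \<bullet> z - h z"
    using axis_in_mixed_strategies
    by (intro continuous_attains_sup compact_mixed_strategies continuous_intros assms) auto
  then have "\<exists>z. is_arg_max (\<lambda>x. y \<bullet> x - h x) (\<lambda>x. x \<in> mixed_strategies) z"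
    by (auto simp: is_arg_max_linorder)
  then have "is_arg_max (\<lambda>x. y \<bullet> x - h x) (\<lambda>x. x \<in> mixed_strategies) (choice_map h y)"
    unfolding choice_map_def arg_max_on_def arg_max_def by (rule someI_ex)
  then show "choice_map h y \<in> mixed_strategies"
    "\<And>x. x \<in> mixed_strategies \<Longrightarrow> y \<bullet> x - h x \<le> y \<bullet> choice_map h y - h (choice_map h y)"
    by (auto simp: is_arg_max_linorder)
qed

text \<open>Strong convexity makes the objective fall off quadratically away from its maximizer, and
  comparing the maximizers for two scores turns this into a Lipschitz estimate. The purpose is to
  let the orbit \<open>X\<close> inherit continuity from the scores.\<close>

lemma choice_map_lipschitz:
  fixes h :: "real ^ 'n \<Rightarrow> real"
  assumes "penalty_function h"
  shows "\<exists>L. L-lipschitz_on UNIV (choice_map h)"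
proof -
  let ?S = "mixed_strategies :: (real ^ 'n) set"
  obtain K where K: "K > 0" and sc: "\<And>x x' t. x \<in> ?S \<Longrightarrow> x' \<in> ?S \<Longrightarrow> t \<in> {0..1} \<Longrightarrow>
      h (t *\<^sub>R x + (1 - t) *\<^sub>R x') \<le> t * h x + (1 - t) * h x' - 1 / 2 * K * t * (1 - t) * (norm (x' - x))\<^sup>2"
    using assms unfolding penalty_function_def strongly_convex_on_def by auto
  note mx = choice_map_maximizes[OF penalty_function_continuous_on[OF assms]]
  \<comment> \<open>Maximality is tested at the midpoint of the maximizer and \<open>z\<close>:
    strong convexity with \<open>t = 1/2\<close> gains a factor \<open>K / 8\<close> there, and
    doubling gives \<open>K / 4\<close>.\<close>
  have growth: "K / 4 * (norm (z - choice_map h y))\<^sup>2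
      \<le> (y \<bullet> choice_map h y - h (choice_map h y)) - (y \<bullet> z - h z)" if z: "z \<in> ?S" for y z
  proof -
    let ?x = "choice_map h y"
    let ?m = "(1/2) *\<^sub>R ?x + (1 - 1/2) *\<^sub>R z"
    have "?m \<in> ?S"
      by (rule convexD[OF convex_mixed_strategies mx(1) z]) auto
    then have "y \<bullet> ?m - h ?m \<le> y \<bullet> ?x - h ?x" by (rule mx(2))
    moreover have "h ?m \<le> 1/2 * h ?x + (1 - 1/2) * h z - 1 / 2 * K * (1/2) * (1 - 1/2) * (norm (z - ?x))\<^sup>2"
      by (rule sc[OF mx(1) z]) auto
    ultimately show ?thesis by (simp add: inner_add_right field_simps)
  qed
  have "dist (choice_map h y) (choice_map h y') \<le> 2 / K * dist y y'" for y y'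
  proof -
    let ?x = "choice_map h y" and ?x' = "choice_map h y'"
    \<comment> \<open>Adding \<open>growth\<close> for the two scores, each tested at the maximizer
      of the other, cancels all values of \<open>h\<close>.\<close>
    have "K / 2 * (norm (?x - ?x'))\<^sup>2 \<le> (y - y') \<bullet> (?x - ?x')"
      using growth[OF mx(1), of y' y] growth[OF mx(1), of y y']
      by (simp add: norm_minus_commute inner_diff_left inner_diff_right)
    also have "\<dots> \<le> norm (y - y') * norm (?x - ?x')" by (rule norm_cauchy_schwarz)
    finally have "(K / 2 * norm (?x - ?x')) * norm (?x - ?x') \<le> norm (y - y') * norm (?x - ?x')"
      by (simp add: power2_eq_square)
    then have "K / 2 * norm (?x - ?x') \<le> norm (y - y')"
      by (cases "?x = ?x'") (auto simp: mult_le_cancel_right)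
    then show ?thesis using K by (simp add: dist_norm field_simps)
  qed
  then have "(2 / K)-lipschitz_on UNIV (choice_map h)"
    using K by (intro lipschitz_onI) auto
  then show ?thesis ..
qed

lemma learning_parameter_continuous_on:
  assumes "learning_parameter \<eta>"
  shows "continuous_on {0..} \<eta>"
proof -
  obtain f' where "\<And>x. x \<in> {0..} \<Longrightarrow> (\<eta> has_derivative f' x) (at x within {0..})"
    using assms by (auto simp: learning_parameter_def)
  then show ?thesis
    by (rule has_derivative_continuous_on)
qed

section \<open>Payoff vectors and indifference\<close>

lemma payoff_vector1_eq: "payoff_vector1 u x $ a = (\<Sum>b\<in>UNIV. u (a, b) * snd x $ b)"
proof -
  have "payoff_vector1 u x $ a = (\<Sum>a'\<in>UNIV. if a' = a then \<Sum>b\<in>UNIV. u (a', b) * snd x $ b else 0)"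
    unfolding payoff_vector1_def expected_payoff_def axis_def
    by (simp only: vec_lambda_beta fst_conv snd_conv, intro sum.cong refl) auto
  then show ?thesis by simp
qed

lemma payoff_vector2_eq: "payoff_vector2 u x $ b = (\<Sum>a\<in>UNIV. u (a, b) * fst x $ a)"
  by (auto simp: payoff_vector2_def expected_payoff_def axis_def if_distrib sum.delta cong: if_cong intro!: sum.cong)

lemma expected_payoff_eq1: "expected_payoff u x = (\<Sum>a\<in>UNIV. fst x $ a * payoff_vector1 u x $ a)"
  by (auto simp: payoff_vector1_eq expected_payoff_def sum_distrib_left intro!: sum.cong)

lemma expected_payoff_eq2: "expected_payoff u x = (\<Sum>b\<in>UNIV. snd x $ b * payoff_vector2 u x $ b)"
  unfolding expected_payoff_def payoff_vector2_eq sum_distrib_left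
  by (subst sum.swap) (auto intro!: sum.cong)

text \<open>With two players a payoff vector involves only the opponent's strategy, so it is linear
  in the whole profile and not just multilinear. This is what allows time averages to be moved
  inside the payoffs.\<close>

lemma linear_payoff_vectors:
  "linear (\<lambda>x. payoff_vector1 u x $ a)" "linear (\<lambda>x. payoff_vector2 u x $ b)"
  by (auto intro!: linearI simp: payoff_vector1_eq payoff_vector2_eq sum.distrib algebra_simps sum_distrib_left)

text \<open>If all actions of a player earn the same amount, so does every mixed strategy, because
  its weights sum to one; hence no deviation gains. A player's own deviation leaves these action
  payoffs unchanged, as they depend on the opponent alone.\<close>

lemma nash_equilibria_if_indifferent:
  assumes x: "x \<in> mixed_profiles"
    and 1: "\<And>a a'. payoff_vector1 u1 x $ a = payoff_vector1 u1 x $ a'"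
    and 2: "\<And>b b'. payoff_vector2 u2 x $ b = payoff_vector2 u2 x $ b'"
  shows "x \<in> nash_equilibria u1 u2"
proof -
  obtain c where c: "\<And>a. payoff_vector1 u1 x $ a = c" using 1 by metis
  obtain d where d: "\<And>b. payoff_vector2 u2 x $ b = d" using 2 by metis
  have p1: "expected_payoff u1 (x1, snd x) = c" if "x1 \<in> mixed_strategies" for x1
  proof -
    have "payoff_vector1 u1 (x1, snd x) $ a = c" for a
      using c[of a] by (simp add: payoff_vector1_eq)
    then have "expected_payoff u1 (x1, snd x) = (\<Sum>a\<in>UNIV. x1 $ a) * c"
      by (simp add: expected_payoff_eq1 sum_distrib_right)
    then show ?thesis using that by (simp add: mixed_strategies_def)
  qed
  have p2: "expected_payoff u2 (fst x, x2) = d" if "x2 \<in> mixed_strategies" for x2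
  proof -
    have "payoff_vector2 u2 (fst x, x2) $ b = d" for b
      using d[of b] by (simp add: payoff_vector2_eq)
    then have "expected_payoff u2 (fst x, x2) = (\<Sum>b\<in>UNIV. x2 $ b) * d"
      by (simp add: expected_payoff_eq2 sum_distrib_right)
    then show ?thesis using that by (simp add: mixed_strategies_def)
  qed
  have "fst x \<in> mixed_strategies" "snd x \<in> mixed_strategies"
    using x by (auto simp: mixed_profiles_def)
  then show ?thesis
    using p1 p2 p1[of "fst x"] p2[of "snd x"] x by (simp add: nash_equilibria_def)
qed

section \<open>Convergence of time averages\<close>

text \<open>\<open>g\<close> measures the failure to lie in \<open>N\<close>. On a compact set
  without zeros of \<open>g\<close> its absolute value has a positive minimum, so the orbit
  eventually avoids that set; this is applied to two such sets.\<close>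

lemma converges_to_set_compact:
  fixes g :: "'v::metric_space \<Rightarrow> real"
  assumes K: "compact K" and g: "continuous_on K g"
    and zero: "\<And>y. y \<in> K \<Longrightarrow> g y = 0 \<Longrightarrow> y \<in> N"
    and x: "eventually (\<lambda>t. x t \<in> K) at_top" and gx: "((\<lambda>t. g (x t)) \<longlongrightarrow> 0) at_top"
  shows "converges_to_set x N"
proof -
  have escape: "eventually (\<lambda>t. x t \<notin> C) at_top"
    if C: "compact C" "C \<subseteq> K" and nz: "\<And>y. y \<in> C \<Longrightarrow> g y \<noteq> 0" for C
  proof (cases "C = {}")
    case False
    have "continuous_on C (\<lambda>y. \<bar>g y\<bar>)"
      using continuous_on_subset[OF g C(2)] by (intro continuous_intros)
    then obtain z where z: "z \<in> C" "\<And>y. y \<in> C \<Longrightarrow> \<bar>g z\<bar> \<le> \<bar>g y\<bar>"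
      using continuous_attains_inf[OF C(1) False] by blast
    have "eventually (\<lambda>t. \<bar>g (x t)\<bar> < \<bar>g z\<bar>) at_top"
      using tendstoD[OF gx, of "\<bar>g z\<bar>"] nz[OF z(1)] by simp
    then show ?thesis
      by eventually_elim (use z(2) in force)
  qed simp
  \<comment> \<open>If \<open>N\<close> were empty, \<open>g\<close> would have no zero on
    \<open>K\<close>, and the orbit would eventually avoid \<open>K\<close> while staying in
    it.\<close>
  have "N \<noteq> {}"
  proof
    assume "N = {}"
    then have "eventually (\<lambda>t. x t \<notin> K) at_top"
      using zero by (intro escape[OF K]) auto
    from eventually_conj[OF x this] show False by simp
  qed
  moreover have "((\<lambda>t. infdist (x t) N) \<longlongrightarrow> 0) at_top"
  proof (rule tendstoI)
    fix e :: real assume e: "0 < e"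
    \<comment> \<open>A zero of \<open>g\<close> in \<open>K\<close> lies in \<open>N\<close> and
      has distance \<open>0 < e\<close>, so \<open>escape\<close> applies to the part of
      \<open>K\<close> that is at least \<open>e\<close> away from \<open>N\<close>.\<close>
    define C where "C = K \<inter> {y. e \<le> infdist y N}"
    have "compact C"
      unfolding C_def
      by (intro compact_Int_closed K closed_Collect_le continuous_intros)
    moreover have "g y \<noteq> 0" if "y \<in> C" for y
      using that zero[of y] e by (auto simp: C_def)
    ultimately have "eventually (\<lambda>t. x t \<notin> C) at_top"
      by (intro escape) (auto simp: C_def)
    with x show "eventually (\<lambda>t. dist (infdist (x t) N) 0 < e) at_top"
      by eventually_elim (auto simp: C_def infdist_nonneg)
  qed
  ultimately show ?thesis by (simp add: converges_to_set_def)
qed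

text \<open>The integral is Lipschitz in \<open>t\<close> with constant \<open>B\<close>, so between
  \<open>n\<^sup>2\<close> and \<open>(n + 1)\<^sup>2\<close> it moves by at most
  \<open>3 * B * n\<close>, which is negligible against \<open>n\<^sup>2\<close>.\<close>

lemma time_average_tendsto_0:
  fixes g :: "real \<Rightarrow> real"
  assumes int: "\<And>t. 0 \<le> t \<Longrightarrow> g integrable_on {0..t}"
    and bd: "\<And>s. 0 \<le> s \<Longrightarrow> \<bar>g s\<bar> \<le> B"
    and lim: "(\<lambda>n. integral {0..(real (Suc n))\<^sup>2} g / (real (Suc n))\<^sup>2) \<longlonglongrightarrow> 0"
  shows "((\<lambda>t. integral {0..t} g / t) \<longlongrightarrow> 0) at_top"
proof -
  \<comment> \<open>Chosen so that \<open>Suc (m t)\<close> is the integer part of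
    \<open>sqrt t\<close> once \<open>1 \<le> t\<close>, matching the index shift in
    \<open>lim\<close>.\<close>
  define m where "m t = nat \<lfloor>sqrt t\<rfloor> - 1" for t
  define G where "G t = integral {0..t} g" for t
  have B: "0 \<le> B" using bd[of 0] by simp
  have m_top: "filterlim m at_top at_top"
    unfolding m_def
    by (rule filterlim_compose[OF filterlim_minus_const_nat_at_top])
       (rule filterlim_compose[OF filterlim_nat_sequentially filterlim_compose[OF filterlim_floor_sequentially sqrt_at_top]])
  have lip: "\<bar>G t - G s\<bar> \<le> B * (t - s)" if "0 \<le> s" "s \<le> t" for s t
  proof -
    have "G t - G s = integral {s..t} g"
      using Henstock_Kurzweil_Integration.integral_combine[OF that int[of t]] that by (simp add: G_def)
    moreover have "g integrable_on cbox s t"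
      using that integrable_subinterval_real[OF int[of t], of s t] by simp
    then have "norm (integral (cbox s t) g) \<le> B * Henstock_Kurzweil_Integration.content (cbox s t)"
      using that bd by (intro integrable_bound B) auto
    ultimately show ?thesis using that by simp
  qed
  have key: "\<bar>G t / t\<bar> \<le> \<bar>G ((real (Suc (m t)))\<^sup>2) / (real (Suc (m t)))\<^sup>2\<bar> + 3 * B / real (Suc (m t))"
    if "1 \<le> t" for t
  proof -
    define n where "n = real (Suc (m t))"
    have "1 \<le> sqrt t" using that by simp
    then have "1 \<le> \<lfloor>sqrt t\<rfloor>" by linarith
    then have "n = of_int \<lfloor>sqrt t\<rfloor>" by (simp add: n_def m_def of_nat_diff)
    then have n: "1 \<le> n" "n \<le> sqrt t" "sqrt t < n + 1" using \<open>1 \<le> \<lfloor>sqrt t\<rfloor>\<close> by linarith+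
    have "n\<^sup>2 \<le> (sqrt t)\<^sup>2" using n by (intro power_mono) auto
    moreover have "(sqrt t)\<^sup>2 \<le> (n + 1)\<^sup>2" using n that by (intro power_mono) auto
    ultimately have t: "n\<^sup>2 \<le> t" "t \<le> (n + 1)\<^sup>2" using that by auto
    have "\<bar>G t\<bar> \<le> \<bar>G (n\<^sup>2)\<bar> + B * (t - n\<^sup>2)" using lip[OF _ t(1)] by simp
    \<comment> \<open>The gap \<open>t - n\<^sup>2\<close> is at most \<open>2 * n + 1\<close>,
      hence at most \<open>3 * n\<close> because \<open>1 \<le> n\<close>.\<close>
    also have "\<dots> \<le> \<bar>G (n\<^sup>2)\<bar> + B * (3 * n)"
      using t n B by (intro add_left_mono mult_left_mono) (auto simp: power2_eq_square algebra_simps)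
    finally have "\<bar>G t\<bar> / t \<le> (\<bar>G (n\<^sup>2)\<bar> + B * (3 * n)) / n\<^sup>2"
      using t n B by (intro frac_le) auto
    also have "\<dots> = \<bar>G (n\<^sup>2) / n\<^sup>2\<bar> + 3 * B / n"
      using n by (simp add: field_simps power2_eq_square)
    finally show ?thesis unfolding n_def using that by simp
  qed
  have "(\<lambda>n. \<bar>G ((real (Suc n))\<^sup>2) / (real (Suc n))\<^sup>2\<bar> + 3 * B / real (Suc n)) \<longlonglongrightarrow> 0 + 0"
    using lim unfolding G_def
    by (intro tendsto_add tendsto_rabs_zero LIMSEQ_Suc[OF lim_const_over_n])
  from filterlim_compose[OF this m_top]
  have "((\<lambda>t. \<bar>G ((real (Suc (m t)))\<^sup>2) / (real (Suc (m t)))\<^sup>2\<bar> + 3 * B / real (Suc (m t))) \<longlongrightarrow> 0) at_top"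
    by simp
  then have "((\<lambda>t. G t / t) \<longlongrightarrow> 0) at_top"
    by (rule Lim_null_comparison[rotated])
      (use key in \<open>auto intro!: eventually_at_top_linorderI[of 1]\<close>)
  then show ?thesis by (simp add: G_def)
qed

section \<open>Time averages of profiles and their payoff differences\<close>

lemma compact_mixed_profiles: "compact mixed_profiles"
  unfolding mixed_profiles_def by (intro compact_Times compact_mixed_strategies)

text \<open>The simplex is cut out by linear conditions on the coordinates, and these pass through
  the integral.\<close>

lemma time_average_in_mixed_strategies:
  fixes p :: "real \<Rightarrow> real ^ 'n"
  assumes t: "0 < t" and int: "p integrable_on {0..t}"
    and p: "\<And>s. 0 \<le> s \<Longrightarrow> p s \<in> mixed_strategies"
  shows "(1 / t) *\<^sub>R integral {0..t} p \<in> mixed_strategies"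
proof -
  have comp: "(\<lambda>s. p s $ i) integrable_on {0..t}" "integral {0..t} (\<lambda>s. p s $ i) = integral {0..t} p $ i" for i
    using integrable_linear[OF int bounded_linear_vec_nth[of i]]
      integral_linear[OF int bounded_linear_vec_nth[of i]] by (simp_all add: comp_def)
  have "0 \<le> integral {0..t} (\<lambda>s. p s $ i)" for i
    using p by (intro Henstock_Kurzweil_Integration.integral_nonneg comp) (auto simp: mixed_strategies_def)
  then have nonneg: "0 \<le> integral {0..t} p $ i" for i by (simp add: comp(2))
  have "(\<Sum>i\<in>UNIV. integral {0..t} p $ i) = integral {0..t} (\<lambda>s. \<Sum>i\<in>UNIV. p s $ i)"
    by (subst Henstock_Kurzweil_Integration.integral_sum) (auto simp: comp)
  also have "\<dots> = integral {0..t} (\<lambda>s. 1)"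
    using p by (intro Henstock_Kurzweil_Integration.integral_cong) (auto simp: mixed_strategies_def)
  also have "\<dots> = t" using t by simp
  finally show ?thesis
    using t nonneg by (auto simp: mixed_strategies_def simp flip: sum_divide_distrib)
qed

lemma time_average_in_mixed_profiles:
  fixes x :: "real \<Rightarrow> (real ^ 'a) \<times> (real ^ 'b)"
  assumes t: "0 < t" and int: "x integrable_on {0..t}"
    and x: "\<And>s. 0 \<le> s \<Longrightarrow> x s \<in> mixed_profiles"
  shows "(1 / t) *\<^sub>R integral {0..t} x \<in> mixed_profiles"
proof -
  have "(1 / t) *\<^sub>R integral {0..t} (\<lambda>s. fst (x s)) \<in> mixed_strategies"
    using integrable_linear[OF int bounded_linear_fst] x
    by (intro time_average_in_mixed_strategies t) (auto simp: comp_def mixed_profiles_def mem_Times_iff)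
  moreover have "(1 / t) *\<^sub>R integral {0..t} (\<lambda>s. snd (x s)) \<in> mixed_strategies"
    using integrable_linear[OF int bounded_linear_snd] x
    by (intro time_average_in_mixed_strategies t) (auto simp: comp_def mixed_profiles_def mem_Times_iff)
  ultimately show ?thesis
    using integral_linear[OF int bounded_linear_fst] integral_linear[OF int bounded_linear_snd]
    by (simp add: mixed_profiles_def mem_Times_iff comp_def)
qed

text \<open>The argument for a single sample path and a single pair of actions, with
  \<open>I\<close> and \<open>I'\<close> as noise. Linearity turns the payoff difference at the
  average into the running average of \<open>L (x s)\<close>; the score equations show that it
  vanishes along squares, and boundedness of \<open>L\<close> on \<open>K\<close> extends this to
  all times.\<close>

lemma score_difference_average_tendsto_0:
  fixes l l' :: "'v::euclidean_space \<Rightarrow> real" and x :: "real \<Rightarrow> 'v" and y y' I I' :: "real \<Rightarrow> real"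
  assumes x: "continuous_on {0..} x" "\<And>t. 0 \<le> t \<Longrightarrow> x t \<in> K" and K: "compact K"
    and l: "linear l" "linear l'"
    and y: "\<And>t. 0 \<le> t \<Longrightarrow> y t = y 0 + integral {0..t} (\<lambda>s. l (x s)) + I t"
    and y': "\<And>t. 0 \<le> t \<Longrightarrow> y' t = y' 0 + integral {0..t} (\<lambda>s. l' (x s)) + I' t"
    and I: "(\<lambda>n. I ((real (Suc n))\<^sup>2) / (real (Suc n))\<^sup>2) \<longlonglongrightarrow> 0"
    and I': "(\<lambda>n. I' ((real (Suc n))\<^sup>2) / (real (Suc n))\<^sup>2) \<longlonglongrightarrow> 0"
    and diff: "(\<lambda>t. y t - y' t) \<in> o[at_top](\<lambda>t. t)"
  shows "((\<lambda>t. l ((1 / t) *\<^sub>R integral {0..t} x) - l' ((1 / t) *\<^sub>R integral {0..t} x)) \<longlongrightarrow> 0) at_top"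
proof -
  define L where "L v = l v - l' v" for v
  have lin: "linear L" unfolding L_def using l by (rule linear_compose_sub)
  have int: "x integrable_on {0..t}" for t
    by (rule integrable_continuous_real) (rule continuous_on_subset[OF x(1)], auto)
  have intl: "(\<lambda>s. f (x s)) integrable_on {0..t}" "integral {0..t} (\<lambda>s. f (x s)) = f (integral {0..t} x)"
    if "linear f" for f :: "'v \<Rightarrow> real" and t
    using integrable_linear[OF int] integral_linear[OF int] that
    by (auto simp: comp_def linear_conv_bounded_linear)
  have "compact (L ` K)"
    using lin by (intro compact_continuous_image linear_continuous_on K) (simp add: linear_conv_bounded_linear)
  then obtain B where B: "\<forall>z\<in>K. \<bar>L z\<bar> \<le> B"
    by (auto dest!: compact_imp_bounded simp: bounded_iff)
  have "(\<lambda>n. integral {0..(real (Suc n))\<^sup>2} (\<lambda>s. L (x s)) / (real (Suc n))\<^sup>2) \<longlonglongrightarrow> 0"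
  proof -
    have sq: "filterlim (\<lambda>n. (real (Suc n))\<^sup>2) at_top sequentially"
      by (intro filterlim_pow_at_top filterlim_compose[OF filterlim_real_sequentially filterlim_Suc]) simp
    have "((\<lambda>t. (y t - y' t) / t) \<longlongrightarrow> 0) at_top" by (rule smalloD_tendsto[OF diff])
    from filterlim_compose[OF this sq]
    have d: "(\<lambda>n. (y ((real (Suc n))\<^sup>2) - y' ((real (Suc n))\<^sup>2)) / (real (Suc n))\<^sup>2) \<longlonglongrightarrow> 0" .
    have c: "(\<lambda>n. (y 0 - y' 0) / (real (Suc n))\<^sup>2) \<longlonglongrightarrow> 0"
      by (rule tendsto_divide_0[OF tendsto_const filterlim_at_top_imp_at_infinity[OF sq]])
    \<comment> \<open>The difference of the two score equations, divided by \<open>t\<close>: score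
      gap, initial gap and noise gap. Each of them tends to \<open>0\<close> along the
      squares.\<close>
    have "integral {0..t} (\<lambda>s. L (x s)) / t = (y t - y' t) / t - (y 0 - y' 0) / t - (I t / t - I' t / t)"
      if "0 \<le> t" for t
      using y[OF that] y'[OF that] unfolding L_def
      by (subst Henstock_Kurzweil_Integration.integral_diff)
        (auto simp: intl l diff_divide_distrib add_divide_distrib)
    then show ?thesis
      using tendsto_diff[OF tendsto_diff[OF d c] tendsto_diff[OF I I']] by simp
  qed
  then have "((\<lambda>t. integral {0..t} (\<lambda>s. L (x s)) / t) \<longlongrightarrow> 0) at_top"
    using B x(2) by (intro time_average_tendsto_0 intl lin) auto
  also have "(\<lambda>t. integral {0..t} (\<lambda>s. L (x s)) / t) = (\<lambda>t. L ((1 / t) *\<^sub>R integral {0..t} x))"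
    by (simp add: intl[OF lin] linear_scale[OF lin])
  finally show ?thesis by (simp add: L_def)
qed

lemma converges_to_nash_if_payoffs_equalize:
  fixes x :: "real \<Rightarrow> (real ^ 'a::finite) \<times> (real ^ 'b::finite)"
  assumes x: "eventually (\<lambda>t. x t \<in> mixed_profiles) at_top"
    and 1: "\<And>a a'. ((\<lambda>t. payoff_vector1 u1 (x t) $ a - payoff_vector1 u1 (x t) $ a') \<longlongrightarrow> 0) at_top"
    and 2: "\<And>b b'. ((\<lambda>t. payoff_vector2 u2 (x t) $ b - payoff_vector2 u2 (x t) $ b') \<longlongrightarrow> 0) at_top"
  shows "converges_to_set x (nash_equilibria u1 u2)"
proof (rule converges_to_set_compact[OF compact_mixed_profiles _ _ x])
  \<comment> \<open>The payoff spread of a profile over all pairs of actions. Being a sum of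
    absolute values, it vanishes only where each player is indifferent among all actions.\<close>
  let ?g1 = "\<lambda>z. \<Sum>a\<in>UNIV. \<Sum>a'\<in>UNIV. \<bar>payoff_vector1 u1 z $ a - payoff_vector1 u1 z $ a'\<bar>"
  let ?g2 = "\<lambda>z. \<Sum>b\<in>UNIV. \<Sum>b'\<in>UNIV. \<bar>payoff_vector2 u2 z $ b - payoff_vector2 u2 z $ b'\<bar>"
  let ?g = "\<lambda>z. ?g1 z + ?g2 z"
  show "continuous_on mixed_profiles ?g"
    using linear_payoff_vectors
    by (intro continuous_intros linear_continuous_on) (simp_all add: linear_conv_bounded_linear)
  show "((\<lambda>t. ?g (x t)) \<longlongrightarrow> 0) at_top"
    by (intro tendsto_add_zero tendsto_null_sum tendsto_rabs_zero 1 2)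
  fix z :: "(real ^ 'a) \<times> (real ^ 'b)"
  assume z: "z \<in> mixed_profiles" and g: "?g z = 0"
  have "?g1 z \<ge> 0" "?g2 z \<ge> 0" by (auto intro!: sum_nonneg)
  with g have "?g1 z = 0" "?g2 z = 0" by linarith+
  then show "z \<in> nash_equilibria u1 u2"
    by (intro nash_equilibria_if_indifferent z) (simp_all add: sum_nonneg_eq_0_iff sum_nonneg)
qed

section \<open>Sample paths of the learning process\<close>

text \<open>Continuity makes the orbit integrable on bounded time intervals, so that
  \<open>time_average\<close> is an honest average and does not rest on the default value of
  \<open>integral\<close>.\<close>

lemma choice_orbit_continuous_on:
  assumes h: "penalty_function h" and \<eta>: "learning_parameter \<eta>"
    and Y: "\<And>i. continuous_on {0..} (\<lambda>t. Y t $ i)"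
  shows "continuous_on {0..} (\<lambda>t. choice_map h (\<eta> t *\<^sub>R Y t))"
proof -
  obtain L where "L-lipschitz_on UNIV (choice_map h)"
    using choice_map_lipschitz[OF h] by blast
  then have Q: "continuous_on UNIV (choice_map h)"
    by (rule lipschitz_on_continuous_on)
  have "continuous_on {0..} (\<lambda>t. \<chi> i. Y t $ i)"
    by (rule continuous_on_vec_lambda) (rule Y)
  then have "continuous_on {0..} (\<lambda>t. \<eta> t *\<^sub>R Y t)"
    by (intro continuous_on_scaleR learning_parameter_continuous_on[OF \<eta>]) simp
  then show ?thesis
    by (rule continuous_on_compose2[OF Q]) simp
qed

text \<open>A Lipschitz diffusion coefficient is continuous, hence bounded on the compact set of
  profiles; so the integrand is bounded along almost every path and the decay along squares applies.
  The drift \<open>b\<close> stays arbitrary, which lets the lemma serve both players.\<close>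

lemma (in prob_space) score_noise_along_squares:
  assumes fil: "filtration_on M F" and W: "wiener_process M F W"
    and lip: "\<exists>L. L-lipschitz_on mixed_profiles s"
    and X: "AE \<omega> in M. \<forall>t\<ge>0. X t \<omega> \<in> mixed_profiles"
    and ito: "has_ito_differential M F W b (\<lambda>t \<omega>. s (X t \<omega>)) Z"
  shows "\<exists>I. AE \<omega> in M.
      (\<forall>t\<ge>0. Z t \<omega> = Z 0 \<omega> + integral {0..t} (\<lambda>r. b r \<omega>) + I t \<omega>) \<and>
      (\<lambda>n. I ((real (Suc n))\<^sup>2) \<omega> / (real (Suc n))\<^sup>2) \<longlonglongrightarrow> 0"
proof -
  obtain I where I: "is_ito_integral M F W (\<lambda>t \<omega>. s (X t \<omega>)) I"
    and Z: "AE \<omega> in M. \<forall>t\<ge>0. (\<lambda>r. b r \<omega>) absolutely_integrable_on {0..t} \<and>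
           Z t \<omega> = Z 0 \<omega> + integral {0..t} (\<lambda>r. b r \<omega>) + I t \<omega>"
    using ito unfolding has_ito_differential_def by blast
  have "compact (s ` mixed_profiles)"
    using lip by (intro compact_continuous_image compact_mixed_profiles) (auto dest: lipschitz_on_continuous_on)
  then obtain C where C: "\<forall>z\<in>mixed_profiles. \<bar>s z\<bar> \<le> C"
    by (auto dest!: compact_imp_bounded simp: bounded_iff)
  have "AE \<omega> in M. \<forall>t\<ge>0. \<bar>s (X t \<omega>)\<bar> \<le> C"
    using X by eventually_elim (use C in blast)
  from ito_integral_along_squares[OF fil W I this] Z
  have "AE \<omega> in M. (\<forall>t\<ge>0. Z t \<omega> = Z 0 \<omega> + integral {0..t} (\<lambda>r. b r \<omega>) + I t \<omega>) \<and>
      (\<lambda>n. I ((real (Suc n))\<^sup>2) \<omega> / (real (Suc n))\<^sup>2) \<longlonglongrightarrow> 0"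
    by eventually_elim blast
  then show ?thesis by (rule exI[of _ I])
qed

theorem theorem6p1:
  fixes M :: "'w measure" and F :: "real \<Rightarrow> 'w measure"
    and W :: "'a::finite + 'b::finite \<Rightarrow> real \<Rightarrow> 'w \<Rightarrow> real"
    and u1 u2 :: "'a \<times> 'b \<Rightarrow> real"
    and h1 :: "real ^ 'a \<Rightarrow> real" and h2 :: "real ^ 'b \<Rightarrow> real"
    and \<eta>1 \<eta>2 :: "real \<Rightarrow> real"
    and \<sigma> :: "'a + 'b \<Rightarrow> (real ^ 'a) \<times> (real ^ 'b) \<Rightarrow> real"
    and Y1 :: "real \<Rightarrow> 'w \<Rightarrow> real ^ 'a" and Y2 :: "real \<Rightarrow> 'w \<Rightarrow> real ^ 'b"
    and X :: "real \<Rightarrow> 'w \<Rightarrow> (real ^ 'a) \<times> (real ^ 'b)"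
  assumes "prob_space M" and "filtration_on M F"
    and "independent_wiener_processes M F W"
    and "\<And>i. \<exists>L. L-lipschitz_on mixed_profiles (\<sigma> i)"
    and "penalty_function h1" and "penalty_function h2"
    and "learning_parameter \<eta>1" and "learning_parameter \<eta>2"
    and "SRL_solution M F W u1 u2 h1 h2 \<eta>1 \<eta>2 \<sigma> Y1 Y2 X"
    and "\<And>\<alpha> \<beta>. AE \<omega> in M. (\<lambda>t. Y1 t \<omega> $ \<alpha> - Y1 t \<omega> $ \<beta>) \<in> o[at_top](\<lambda>t. t)"
    and "\<And>\<alpha> \<beta>. AE \<omega> in M. (\<lambda>t. Y2 t \<omega> $ \<alpha> - Y2 t \<omega> $ \<beta>) \<in> o[at_top](\<lambda>t. t)"
  shows "AE \<omega> in M. converges_to_set (\<lambda>t. time_average X t \<omega>) (nash_equilibria u1 u2)"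
proof -
  interpret prob_space M by fact
  have wiener: "wiener_process M F (W i)" for i
    using assms(3) by (simp add: independent_wiener_processes_def)
  have d1: "has_ito_differential M F (W (Inl a)) (\<lambda>t \<omega>. payoff_vector1 u1 (X t \<omega>) $ a)
      (\<lambda>t \<omega>. \<sigma> (Inl a) (X t \<omega>)) (\<lambda>t \<omega>. Y1 t \<omega> $ a)"
    and d2: "has_ito_differential M F (W (Inr b)) (\<lambda>t \<omega>. payoff_vector2 u2 (X t \<omega>) $ b)
      (\<lambda>t \<omega>. \<sigma> (Inr b) (X t \<omega>)) (\<lambda>t \<omega>. Y2 t \<omega> $ b)"
    and X: "AE \<omega> in M. \<forall>t\<ge>0. X t \<omega> =
        (choice_map h1 (\<eta>1 t *\<^sub>R Y1 t \<omega>), choice_map h2 (\<eta>2 t *\<^sub>R Y2 t \<omega>))" for a b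
    using assms(9) by (auto simp: SRL_solution_def)
  have Q: "choice_map h1 y \<in> mixed_strategies" "choice_map h2 z \<in> mixed_strategies" for y z
    using assms(5,6) by (auto intro!: choice_map_maximizes(1) penalty_function_continuous_on)
  have X_in: "AE \<omega> in M. \<forall>t\<ge>0. X t \<omega> \<in> mixed_profiles"
    using X by eventually_elim (simp add: mixed_profiles_def Q)
  have "\<forall>a. \<exists>I. AE \<omega> in M.
      (\<forall>t\<ge>0. Y1 t \<omega> $ a = Y1 0 \<omega> $ a + integral {0..t} (\<lambda>r. payoff_vector1 u1 (X r \<omega>) $ a) + I t \<omega>) \<and>
      (\<lambda>n. I ((real (Suc n))\<^sup>2) \<omega> / (real (Suc n))\<^sup>2) \<longlonglongrightarrow> 0"
    by (intro allI score_noise_along_squares[OF assms(2) wiener assms(4) X_in d1])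
  \<comment> \<open>One noise process per action is fixed before passing to sample paths, since its
    choice must not depend on \<open>\<omega>\<close>.\<close>
  from choice[OF this] obtain I1 where I1': "\<forall>a. AE \<omega> in M.
      (\<forall>t\<ge>0. Y1 t \<omega> $ a = Y1 0 \<omega> $ a + integral {0..t} (\<lambda>r. payoff_vector1 u1 (X r \<omega>) $ a) + I1 a t \<omega>) \<and>
      (\<lambda>n. I1 a ((real (Suc n))\<^sup>2) \<omega> / (real (Suc n))\<^sup>2) \<longlonglongrightarrow> 0" ..
  \<comment> \<open>There are finitely many actions, so the exceptional null sets unite to a null
    set and the quantifier moves under \<open>AE\<close>.\<close>
  note I1 = I1'[folded AE_all_countable]
  have "\<forall>b. \<exists>I. AE \<omega> in M.
      (\<forall>t\<ge>0. Y2 t \<omega> $ b = Y2 0 \<omega> $ b + integral {0..t} (\<lambda>r. payoff_vector2 u2 (X r \<omega>) $ b) + I t \<omega>) \<and>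
      (\<lambda>n. I ((real (Suc n))\<^sup>2) \<omega> / (real (Suc n))\<^sup>2) \<longlonglongrightarrow> 0"
    by (intro allI score_noise_along_squares[OF assms(2) wiener assms(4) X_in d2])
  from choice[OF this] obtain I2 where I2': "\<forall>b. AE \<omega> in M.
      (\<forall>t\<ge>0. Y2 t \<omega> $ b = Y2 0 \<omega> $ b + integral {0..t} (\<lambda>r. payoff_vector2 u2 (X r \<omega>) $ b) + I2 b t \<omega>) \<and>
      (\<lambda>n. I2 b ((real (Suc n))\<^sup>2) \<omega> / (real (Suc n))\<^sup>2) \<longlonglongrightarrow> 0" ..
  note I2 = I2'[folded AE_all_countable]
  have all: "AE \<omega> in M. \<forall>i. P i \<omega>" if "\<And>i. AE \<omega> in M. P i \<omega>" for P :: "'i::finite \<Rightarrow> 'w \<Rightarrow> bool"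
    using that by (simp add: AE_all_countable)
  have cont1: "AE \<omega> in M. \<forall>a. continuous_on {0..} (\<lambda>t. Y1 t \<omega> $ a)"
    using d1 by (intro all) (simp add: has_ito_differential_def continuous_process_def)
  have cont2: "AE \<omega> in M. \<forall>b. continuous_on {0..} (\<lambda>t. Y2 t \<omega> $ b)"
    using d2 by (intro all) (simp add: has_ito_differential_def continuous_process_def)
  have sublinear1: "AE \<omega> in M. \<forall>\<alpha> \<beta>. (\<lambda>t. Y1 t \<omega> $ \<alpha> - Y1 t \<omega> $ \<beta>) \<in> o[at_top](\<lambda>t. t)"
    and sublinear2: "AE \<omega> in M. \<forall>\<alpha> \<beta>. (\<lambda>t. Y2 t \<omega> $ \<alpha> - Y2 t \<omega> $ \<beta>) \<in> o[at_top](\<lambda>t. t)"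
    by (intro all assms(10,11))+
  \<comment> \<open>From here on a path outside a common null set is fixed, and the argument is
    deterministic.\<close>
  show ?thesis
    using X X_in I1 I2 cont1 cont2 sublinear1 sublinear2
  proof eventually_elim
    case (elim \<omega>)
    have c: "continuous_on {0..} (\<lambda>t. X t \<omega>)"
    proof -
      have "continuous_on {0..} (\<lambda>t. (choice_map h1 (\<eta>1 t *\<^sub>R Y1 t \<omega>), choice_map h2 (\<eta>2 t *\<^sub>R Y2 t \<omega>)))"
        using elim(5,6) assms(5-8) by (intro continuous_on_Pair choice_orbit_continuous_on) auto
      then show ?thesis
        by (rule continuous_on_cong[THEN iffD1, rotated -1]) (use elim(1) in auto)
    qed
    have int: "(\<lambda>t. X t \<omega>) integrable_on {0..t}" for t
      by (rule integrable_continuous_real) (rule continuous_on_subset[OF c], auto)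
    have X_in: "X t \<omega> \<in> mixed_profiles" if "0 \<le> t" for t
      using elim(2) that by blast
    have Y1: "Y1 t \<omega> $ a = Y1 0 \<omega> $ a
        + integral {0..t} (\<lambda>r. payoff_vector1 u1 (X r \<omega>) $ a) + I1 a t \<omega>" if "0 \<le> t" for a t
      using elim(3) that by blast
    have lim1: "(\<lambda>n. I1 a ((real (Suc n))\<^sup>2) \<omega> / (real (Suc n))\<^sup>2) \<longlonglongrightarrow> 0" for a
      using elim(3) by blast
    have Y2: "Y2 t \<omega> $ b = Y2 0 \<omega> $ b
        + integral {0..t} (\<lambda>r. payoff_vector2 u2 (X r \<omega>) $ b) + I2 b t \<omega>" if "0 \<le> t" for b t
      using elim(4) that by blast
    have lim2: "(\<lambda>n. I2 b ((real (Suc n))\<^sup>2) \<omega> / (real (Suc n))\<^sup>2) \<longlonglongrightarrow> 0" for b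
      using elim(4) by blast
    show "converges_to_set (\<lambda>t. time_average X t \<omega>) (nash_equilibria u1 u2)"
    proof (rule converges_to_nash_if_payoffs_equalize)
      show "eventually (\<lambda>t. time_average X t \<omega> \<in> mixed_profiles) at_top"
        \<comment> \<open>At \<open>t = 0\<close> division by zero turns the average into the zero
          vector, which is not a profile; hence the restriction to positive times.\<close>
        using eventually_gt_at_top[of 0]
        by eventually_elim
          (use X_in int in \<open>auto simp: time_average_def intro!: time_average_in_mixed_profiles\<close>)
      fix a a'
      show "((\<lambda>t. payoff_vector1 u1 (time_average X t \<omega>) $ a
          - payoff_vector1 u1 (time_average X t \<omega>) $ a') \<longlongrightarrow> 0) at_top"
        unfolding time_average_def
        \<comment> \<open>The sublinear growth of the score differences enters here, as
          \<open>elim(7)\<close> for the pair \<open>a\<close>, \<open>a'\<close>.\<close>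
        by (rule score_difference_average_tendsto_0[OF c X_in compact_mixed_profiles
              linear_payoff_vectors(1) linear_payoff_vectors(1) Y1 Y1 lim1 lim1
              elim(7)[rule_format]])
    next
      fix b b'
      show "((\<lambda>t. payoff_vector2 u2 (time_average X t \<omega>) $ b
          - payoff_vector2 u2 (time_average X t \<omega>) $ b') \<longlongrightarrow> 0) at_top"
        unfolding time_average_def
        by (rule score_difference_average_tendsto_0[OF c X_in compact_mixed_profiles
              linear_payoff_vectors(2) linear_payoff_vectors(2) Y2 Y2 lim2 lim2
              elim(8)[rule_format]])
    qed
  qed
qed

end
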